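(* For every $x\in(\lambda,\lambda^{-1})$, the game $\mathrm{Standard}(x)=\mathrm{Trail}(0,1,x,0)$ has at least two time-invariant Nash equilibria that are not shift equivalent.
   Context: Trail of Lost Pennies $\mathrm{Trail}(m_{-\infty},m_\infty,n_{-\infty},n_\infty)$ (data with $m_{-\infty}<m_\infty$, $n_\infty<n_{-\infty}$, and fixed reals $m_*\le m_{-\infty}$, $n_*\le n_\infty$): a strategy is a map $S:\mathbb{Z}\times\mathbb{N}_+\to[0,\infty)$, time-invariant if $S(i,j)$ does not depend on $j$. For a strategy pair $(S_-,S_+)$ (Mina's, Maxine's) and $k\in\mathbb{Z}$, gameplay $X:\mathbb{N}\to\mathbb{Z}$ has $X_0=k$ and, given the past, steps $+1$ with probability $\frac{S_+(X_{i-1},i)}{S_-(X_{i-1},i)+S_+(X_{i-1},i)}$ and $-1$ otherwise ($0/0=1/2$). With $E_-=\{\limsup X_n=-\infty\}$, $E_+=\{\liminf X_n=\infty\}$, $E=E_-\cup E_+$: Mina's payoff $P_-=-\sum_{t\ge1}S_-(X_{t-1},t)+T_-$, $T_-=n_{-\infty},n_\infty,n_*$ on $E_-,E_+,E^c$; Maxine's payoff $P_+=-\sum_{t\ge1}S_+(X_{t-1},t)+T_+$, $T_+=m_{-\infty},m_\infty,m_*$ on $E_-,E_+,E^c$. $(S_-,S_+)$ is a Nash equilibrium if for every strategy $S$ and every starting point $k$, $\mathbb{E}^k_{S_-,S_+}[P_+]\ge\mathbb{E}^k_{S_-,S}[P_+]$ and $\mathbb{E}^k_{S_-,S_+}[P_-]\ge\mathbb{E}^k_{S,S_+}[P_-]$.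 Time-invariant pairs are written $\{(b_i,a_i):i\in\mathbb{Z}\}$; two such pairs are shift equivalent if there is $k\in\mathbb{Z}$ with $(b_i,a_i)=(b'_{i+k},a'_{i+k})$ for all $i$. $\lambda\in(0,1]$ denotes the infimum of the Mina margins $\frac{n_{-\infty}-n_\infty}{m_\infty-m_{-\infty}}$ of positive solutions of the ABMN system (variables $a_i,b_i>0$, $m_i,n_i\in\mathbb{R}$ with, for all $i$, $(a_i+b_i)(m_i+a_i)=a_im_{i+1}+b_im_{i-1}$, $(a_i+b_i)(n_i+b_i)=a_in_{i+1}+b_in_{i-1}$, $(a_i+b_i)^2=b_i(m_{i+1}-m_{i-1})$, $(a_i+b_i)^2=a_i(n_{i-1}-n_{i+1})$; $m_{\pm\infty},n_{\pm\infty}$ the limits as $i\to\pm\infty$); the set of these margins equals $[\lambda,\lambda^{-1}]$ and $\lambda<1$. *)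

theory Defs
  imports "HOL-Probability.Probability"
begin

text \<open>A strategy is a map Z x N_+ -> [0,oo); we use int => nat => real and only
  require (and only use) nonnegativity for time indices j >= 1.\<close>

definition strategy :: "(int \<Rightarrow> nat \<Rightarrow> real) \<Rightarrow> bool" where
  "strategy S \<longleftrightarrow> (\<forall>i j. 0 < j \<longrightarrow> 0 \<le> S i j)"

definition up_prob :: "(int \<Rightarrow> nat \<Rightarrow> real) \<Rightarrow> (int \<Rightarrow> nat \<Rightarrow> real) \<Rightarrow> int \<Rightarrow> nat \<Rightarrow> real" where
  "up_prob Sm Sp i j = (if Sm i j + Sp i j = 0 then 1/2 else Sp i j / (Sm i j + Sp i j))"

definition Omega :: "(nat \<Rightarrow> real) measure" where
  "Omega = PiM UNIV (\<lambda>_. uniform_measure lborel {0..1})"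

text \<open>Gameplay X started at k: step t+1 (from X_t to X_(t+1)) goes up iff
  U_t < up_prob at (X_t, t+1), so that given the past the step is +1 with the
  required probability.\<close>
fun path :: "(int \<Rightarrow> nat \<Rightarrow> real) \<Rightarrow> (int \<Rightarrow> nat \<Rightarrow> real) \<Rightarrow> int \<Rightarrow> (nat \<Rightarrow> real) \<Rightarrow> nat \<Rightarrow> int" where
  "path Sm Sp k \<omega> 0 = k"
| "path Sm Sp k \<omega> (Suc t) = path Sm Sp k \<omega> t +
     (if \<omega> t < up_prob Sm Sp (path Sm Sp k \<omega> t) (Suc t) then 1 else -1)"

definition term_value :: "real \<Rightarrow> real \<Rightarrow> real \<Rightarrow> (nat \<Rightarrow> int) \<Rightarrow> real" where
  "term_value vneg vpos vstar X =
     (if filterlim X at_bot sequentially then vneg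
      else if filterlim X at_top sequentially then vpos else vstar)"

text \<open>Expected payoff (in the extended reals, since total stake may be infinite) of the
  player whose strategy is Sown, with terminal values tneg, tpos, tstar, under the
  strategy pair (Sm, Sp) started at k.\<close>
definition exp_payoff ::
  "(int \<Rightarrow> nat \<Rightarrow> real) \<Rightarrow> (int \<Rightarrow> nat \<Rightarrow> real) \<Rightarrow> (int \<Rightarrow> nat \<Rightarrow> real)
     \<Rightarrow> real \<Rightarrow> real \<Rightarrow> real \<Rightarrow> int \<Rightarrow> ereal" where
  "exp_payoff Sm Sp Sown tneg tpos tstar k =
     ereal (\<integral>\<omega>. term_value tneg tpos tstar (path Sm Sp k \<omega>) \<partial>Omega)
     - enn2ereal (\<integral>\<^sup>+\<omega>. (\<Sum>t. ennreal (Sown (path Sm Sp k \<omega> t) (Suc t))) \<partial>Omega)"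

definition mina_payoff where
  "mina_payoff nneg npos nstar Sm Sp k = exp_payoff Sm Sp Sm nneg npos nstar k"

definition maxine_payoff where
  "maxine_payoff mneg mpos mstar Sm Sp k = exp_payoff Sm Sp Sp mneg mpos mstar k"

definition nash_eq ::
  "real \<Rightarrow> real \<Rightarrow> real \<Rightarrow> real \<Rightarrow> real \<Rightarrow> real
     \<Rightarrow> (int \<Rightarrow> nat \<Rightarrow> real) \<Rightarrow> (int \<Rightarrow> nat \<Rightarrow> real) \<Rightarrow> bool" where
  "nash_eq mneg mpos nneg npos mstar nstar Sm Sp \<longleftrightarrow>
     strategy Sm \<and> strategy Sp \<and>
     (\<forall>S k. strategy S \<longrightarrow>
        maxine_payoff mneg mpos mstar Sm S k \<le> maxine_payoff mneg mpos mstar Sm Sp k) \<and>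
     (\<forall>S k. strategy S \<longrightarrow>
        mina_payoff nneg npos nstar S Sp k \<le> mina_payoff nneg npos nstar Sm Sp k)"

definition abmn_positive ::
  "(int \<Rightarrow> real) \<Rightarrow> (int \<Rightarrow> real) \<Rightarrow> (int \<Rightarrow> real) \<Rightarrow> (int \<Rightarrow> real) \<Rightarrow> bool" where
  "abmn_positive a b m n \<longleftrightarrow>
     (\<forall>i. 0 < a i \<and> 0 < b i
        \<and> (a i + b i) * (m i + a i) = a i * m (i+1) + b i * m (i-1)
        \<and> (a i + b i) * (n i + b i) = a i * n (i+1) + b i * n (i-1)
        \<and> (a i + b i)^2 = b i * (m (i+1) - m (i-1))
        \<and> (a i + b i)^2 = a i * (n (i-1) - n (i+1)))
     \<and> (\<exists>L. (m \<longlongrightarrow> L) at_bot) \<and> (\<exists>L. (m \<longlongrightarrow> L) at_top)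
     \<and> (\<exists>L. (n \<longlongrightarrow> L) at_bot) \<and> (\<exists>L. (n \<longlongrightarrow> L) at_top)"

definition mina_margin :: "(int \<Rightarrow> real) \<Rightarrow> (int \<Rightarrow> real) \<Rightarrow> real" where
  "mina_margin m n = (Lim at_bot n - Lim at_top n) / (Lim at_top m - Lim at_bot m)"

definition lambda_ABMN :: real where
  "lambda_ABMN = Inf {mina_margin m n | a b m n. abmn_positive a b m n}"

end

theory Submission
  imports Defs
begin

text \<open>
  In a positive ABMN solution the ratios \<open>\<beta>\<^sub>i = b\<^sub>i / a\<^sub>i\<close> satisfy
  \<open>\<beta>\<^sub>i\<^sub>+\<^sub>1 (1 + 2 \<beta>\<^sub>i\<^sub>+\<^sub>1) = \<beta>\<^sub>i\<^sup>2 / (2 + \<beta>\<^sub>i)\<close>, an increasing recursion conjugate to its own inverse under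
  \<open>\<beta> \<mapsto> 1/\<beta>\<close>, and up to an affine change of \<open>m\<close> and \<open>n\<close> the solution is determined by \<open>\<beta>\<^sub>0\<close>.
  The Mina margin is thus a continuous function of \<open>\<beta>\<^sub>0\<close> that is constant along orbits of the recursion,
  and \<open>\<beta>\<^sub>0 \<mapsto> 1/\<beta>\<^sub>0\<close> inverts it. On the circle of orbits it takes every
  value strictly between \<open>\<lambda>\<close> and \<open>1/\<lambda>\<close> at least twice.

  A solution is a Nash equilibrium because \<open>m(X\<^sub>t)\<close> minus Maxine's running cost is a supermartingale
  whatever she stakes against \<open>b\<close>, and a martingale if she stakes \<open>a\<close>; likewise for Mina.
\<close>

section \<open>The recursion for the stake ratio\<close>

text \<open>For \<open>y >= 0\<close> this is the nonnegative root \<open>z\<close> of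
  \<open>z * (1 + 2 * z) = y^2 / (2 + y)\<close>, in closed form so that continuity can be read
  off.\<close>

definition ratio_step :: "real \<Rightarrow> real" where
  "ratio_step y = (sqrt (1 + 8 * (y\<^sup>2 / (2 + y))) - 1) / 4"

lemma ratio_step_0 [simp]: "ratio_step 0 = 0"
  by (simp add: ratio_step_def)

lemma ratio_step_nonneg: "0 \<le> y \<Longrightarrow> 0 \<le> ratio_step y"
  by (simp add: ratio_step_def)

lemma ratio_step_pos: "0 < y \<Longrightarrow> 0 < ratio_step y"
  by (simp add: ratio_step_def)

lemma ratio_step_eq:
  assumes "0 \<le> y"
  shows "ratio_step y * (1 + 2 * ratio_step y) = y\<^sup>2 / (2 + y)"
proof -
  define q where "q = y\<^sup>2 / (2 + y)"
  have "0 \<le> q" using assms by (simp add: q_def)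
  then have "(sqrt (1 + 8 * q))\<^sup>2 = 1 + 8 * q" by simp
  moreover have "(s - 1) / 4 * (1 + 2 * ((s - 1) / 4)) = (s\<^sup>2 - 1) / 8" for s :: real
    by (simp add: power2_eq_square field_simps)
  ultimately have "(sqrt (1 + 8 * q) - 1) / 4 * (1 + 2 * ((sqrt (1 + 8 * q) - 1) / 4)) = q"
    by (metis add_diff_cancel_left' nonzero_mult_div_cancel_left zero_neq_numeral)
  then show ?thesis
    unfolding ratio_step_def q_def .
qed

lemma quadratic_strict_mono:
  fixes s t :: real
  assumes "0 \<le> s" "s < t"
  shows "s * (1 + 2 * s) < t * (1 + 2 * t)"
  using assms by (intro mult_strict_mono') auto

lemma ratio_step_eqI:
  assumes "0 \<le> y" "0 \<le> z" "z * (1 + 2 * z) = y\<^sup>2 / (2 + y)"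
  shows "ratio_step y = z"
  using quadratic_strict_mono[of z "ratio_step y"] quadratic_strict_mono[of "ratio_step y" z]
    ratio_step_eq[OF assms(1)] ratio_step_nonneg[OF assms(1)] assms
  by (metis linorder_neq_iff)

lemma ratio_step_strict_mono:
  assumes "0 \<le> y" "y < z"
  shows "ratio_step y < ratio_step z"
proof -
  have "y * y < z * z" using assms by (intro mult_strict_mono') auto
  moreover have "y * y * z \<le> z * z * y"
    using mult_left_mono[of y z "y * z"] assms by (simp add: mult_ac)
  ultimately have "y\<^sup>2 / (2 + y) < z\<^sup>2 / (2 + z)"
    using assms by (simp add: divide_simps power2_eq_square algebra_simps)
  then show ?thesis by (simp add: ratio_step_def)
qed

lemma ratio_step_mono: "0 \<le> y \<Longrightarrow> y \<le> z \<Longrightarrow> ratio_step y \<le> ratio_step z"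
  using ratio_step_strict_mono[of y z] by fastforce

text \<open>The increasing quadratic \<open>z * (1 + 2 * z)\<close> at \<open>z = y / 2\<close> is
  already at least \<open>y^2 / (2 + y)\<close>. The geometric decay of orbits rests on this
  bound.\<close>

lemma ratio_step_le_half:
  assumes "0 \<le> y"
  shows "ratio_step y \<le> y / 2"
proof (rule ccontr)
  assume "\<not> ?thesis"
  then have "y / 2 * (1 + 2 * (y / 2)) < y\<^sup>2 / (2 + y)"
    using quadratic_strict_mono[of "y / 2" "ratio_step y"] ratio_step_eq[OF assms] assms by simp
  moreover have "y\<^sup>2 / (2 + y) \<le> y / 2 * (1 + 2 * (y / 2))"
    using assms by (simp add: divide_simps power2_eq_square algebra_simps)
  ultimately show False by simp
qed

lemma continuous_on_ratio_step: "continuous_on {0..} ratio_step"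
  unfolding ratio_step_def by (intro continuous_intros) auto

text \<open>Taking reciprocals in the defining equation gives the same equation with argument
  \<open>inverse z\<close> and root \<open>inverse y\<close>. Hence reciprocals run an orbit
  backwards.\<close>

lemma ratio_step_inverse:
  assumes "0 < y"
  shows "ratio_step (inverse (ratio_step y)) = inverse y"
proof (rule ratio_step_eqI)
  define z where "z = ratio_step y"
  have z: "0 < z" "z * (1 + 2 * z) = y\<^sup>2 / (2 + y)"
    using assms ratio_step_pos ratio_step_eq by (auto simp: z_def)
  have "inverse y * (1 + 2 * inverse y) = inverse (y\<^sup>2 / (2 + y))"
    using assms by (simp add: field_simps power2_eq_square)
  also have "\<dots> = inverse (z * (1 + 2 * z))" using z by simp
  also have "\<dots> = (inverse z)\<^sup>2 / (2 + inverse z)"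
    using z(1) by (simp add: field_simps power2_eq_square)
  finally show "inverse y * (1 + 2 * inverse y) = (inverse (ratio_step y))\<^sup>2 / (2 + inverse (ratio_step y))"
    by (simp add: z_def)
qed (use assms ratio_step_pos in \<open>auto simp: less_imp_le\<close>)

lemma funpow_ratio_step_nonneg: "0 \<le> y \<Longrightarrow> 0 \<le> (ratio_step ^^ n) y"
  by (induction n) (auto simp: ratio_step_nonneg)

lemma funpow_ratio_step_pos: "0 < y \<Longrightarrow> 0 < (ratio_step ^^ n) y"
  by (induction n) (auto simp: ratio_step_pos)

lemma funpow_ratio_step_mono:
  "0 \<le> y \<Longrightarrow> y \<le> z \<Longrightarrow> (ratio_step ^^ n) y \<le> (ratio_step ^^ n) z"
  by (induction n) (auto simp: ratio_step_mono funpow_ratio_step_nonneg)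

lemma continuous_on_funpow_ratio_step: "continuous_on {0..} (ratio_step ^^ n)"
proof (induction n)
  case (Suc n)
  have "continuous_on {0..} (ratio_step \<circ> (ratio_step ^^ n))"
    by (rule continuous_on_compose[OF Suc], rule continuous_on_subset[OF continuous_on_ratio_step])
      (auto simp: funpow_ratio_step_nonneg)
  then show ?case by (simp add: o_def)
qed (simp add: id_def)

lemma funpow_ratio_step_le:
  assumes "0 \<le> y"
  shows "(ratio_step ^^ n) y \<le> y * (1 / 2) ^ n"
proof (induction n)
  case (Suc n)
  then show ?case
    using ratio_step_le_half[OF funpow_ratio_step_nonneg[OF assms, of n]] by simp
qed simp

lemma funpow_ratio_step_tendsto_0:
  assumes "0 \<le> y"
  shows "(\<lambda>n. (ratio_step ^^ n) y) \<longlonglongrightarrow> 0"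
proof (rule tendsto_sandwich[OF _ _ tendsto_const])
  show "(\<lambda>n. y * (1 / 2) ^ n) \<longlonglongrightarrow> 0"
    by (rule tendsto_mult_right_zero) (rule LIMSEQ_power_zero, simp)
qed (auto simp: funpow_ratio_step_nonneg funpow_ratio_step_le assms)

section \<open>Two-sided orbits of the recursion\<close>

lemma int_shift_invariant:
  fixes f :: "int \<Rightarrow> 'a"
  assumes "\<And>i. f (i + 1) = f i"
  shows "f i = f 0"
proof (induction i rule: int_induct[where k = 0])
  case (step2 i)
  then show ?case using assms[of "i - 1"] by simp
qed (use assms in auto)

definition ratio_orbit :: "(int \<Rightarrow> real) \<Rightarrow> bool" where
  "ratio_orbit \<beta> \<longleftrightarrow> (\<forall>i. 0 < \<beta> i \<and> \<beta> (i + 1) = ratio_step (\<beta> i))"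

lemma ratio_orbit_reflect:
  assumes "ratio_orbit \<beta>"
  shows "ratio_orbit (\<lambda>i. inverse (\<beta> (- i)))"
  unfolding ratio_orbit_def
proof safe
  fix i
  have "\<beta> (- i) = ratio_step (\<beta> (- i - 1))" and pos: "0 < \<beta> (- i - 1)"
    using assms[unfolded ratio_orbit_def, rule_format, of "- i - 1"] by auto
  then show "inverse (\<beta> (- (i + 1))) = ratio_step (inverse (\<beta> (- i)))"
    using ratio_step_inverse[OF pos] by simp
qed (use assms in \<open>auto simp: ratio_orbit_def\<close>)

lemma ratio_orbit_funpow:
  assumes "ratio_orbit \<beta>"
  shows "\<beta> (int n) = (ratio_step ^^ n) (\<beta> 0)"
proof (induction n)
  case (Suc n)
  then show ?case
    using assms[unfolded ratio_orbit_def, rule_format, of "int n"] by (simp add: add.commute)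
qed simp

text \<open>Halving at each step gives the limit 0; positivity gives the approach from the right,
  the form that composes with reciprocals and with limits at 0.\<close>

lemma ratio_orbit_at_top:
  assumes "ratio_orbit \<beta>"
  shows "filterlim \<beta> (at_right 0) at_top"
proof -
  have "((\<lambda>i. (ratio_step ^^ nat i) (\<beta> 0)) \<longlongrightarrow> 0) at_top"
    using funpow_ratio_step_tendsto_0[of "\<beta> 0"] filterlim_compose[OF _ filterlim_nat_sequentially]
      assms by (auto simp: ratio_orbit_def less_imp_le)
  moreover have "\<forall>\<^sub>F i in at_top. (ratio_step ^^ nat i) (\<beta> 0) = \<beta> i"
    using eventually_ge_at_top[of "0::int"]
  proof eventually_elim
    case (elim i)
    then show ?case using ratio_orbit_funpow[OF assms, of "nat i"] by simp
  qed
  ultimately have "(\<beta> \<longlongrightarrow> 0) at_top" by (rule Lim_transform_eventually)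
  then show ?thesis
    using assms by (auto simp: filterlim_at ratio_orbit_def less_imp_neq[THEN not_sym])
qed

lemma filterlim_uminus_int:
  "filterlim (uminus :: int \<Rightarrow> int) at_top at_bot" "filterlim (uminus :: int \<Rightarrow> int) at_bot at_top"
proof -
  have "\<forall>\<^sub>F i in at_bot. Z \<le> - i" for Z :: int
    using eventually_le_at_bot[of "- Z"] by eventually_elim auto
  then show "filterlim (uminus :: int \<Rightarrow> int) at_top at_bot" by (simp add: filterlim_at_top)
  have "\<forall>\<^sub>F i in at_top. - i \<le> Z" for Z :: int
    using eventually_ge_at_top[of "- Z"] by eventually_elim auto
  then show "filterlim (uminus :: int \<Rightarrow> int) at_bot at_top" by (simp add: filterlim_at_bot)
qed

lemma ratio_orbit_at_bot:
  assumes "ratio_orbit \<beta>"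
  shows "filterlim \<beta> at_top at_bot"
proof -
  have "filterlim (\<lambda>i. \<beta> (- i)) at_top at_top"
    using filterlim_compose[OF filterlim_inverse_at_top_right
        ratio_orbit_at_top[OF ratio_orbit_reflect[OF assms]]] by simp
  then have "filterlim (\<lambda>i. \<beta> (- (- i))) at_top at_bot"
    using filterlim_uminus_int(1) by (rule filterlim_compose)
  then show ?thesis by simp
qed

lemma ratio_orbit_exists:
  assumes "0 < y"
  shows "\<exists>\<beta>. ratio_orbit \<beta> \<and> \<beta> 0 = y"
proof -
  \<comment> \<open>The backward half is the reflected forward orbit of
    \<open>inverse y\<close>.\<close>
  define \<beta> where "\<beta> i = (if 0 \<le> i then (ratio_step ^^ nat i) y
    else inverse ((ratio_step ^^ nat (- i)) (inverse y)))" for i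
  have "\<beta> (i + 1) = ratio_step (\<beta> i)" for i
  proof (cases "0 \<le> i")
    case True
    then have "nat (i + 1) = Suc (nat i)" by simp
    then show ?thesis using True by (simp add: \<beta>_def)
  next
    case False
    define n where "n = nat (- i - 1)"
    have n: "nat (- i) = Suc n" "n = nat (- (i + 1))" using False by (auto simp: n_def)
    have "ratio_step (\<beta> i) = inverse ((ratio_step ^^ n) (inverse y))"
      using False n(1) ratio_step_inverse[OF funpow_ratio_step_pos[of "inverse y" n]] assms
      by (simp add: \<beta>_def)
    also have "\<dots> = \<beta> (i + 1)"
      using False n(2) by (cases "i = -1") (auto simp: \<beta>_def)
    finally show ?thesis by simp
  qed
  moreover have "0 < \<beta> i" for i
    using assms funpow_ratio_step_pos by (simp add: \<beta>_def)
  ultimately have "ratio_orbit \<beta>" by (simp add: ratio_orbit_def)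
  moreover have "\<beta> 0 = y" by (simp add: \<beta>_def)
  ultimately show ?thesis by blast
qed

text \<open>The values \<open>y\<close> with \<open>ratio_step y < c < y\<close> lie within one
  period, and orbits decrease, so an orbit meets them at most once and the shift \<open>k\<close>
  must be 0. This is what rules out shift equivalence in the end.\<close>

lemma ratio_orbit_fundamental_domain:
  assumes \<beta>: "ratio_orbit \<beta>" "c < \<beta> 0" "ratio_step (\<beta> 0) < c"
    and \<gamma>: "ratio_orbit \<gamma>" "c < \<gamma> 0" "ratio_step (\<gamma> 0) < c"
    and eq: "\<And>i. \<beta> i = \<gamma> (i + k)"
  shows "\<beta> 0 = \<gamma> 0"
proof -
  have below: "\<delta> j < c" if "ratio_orbit \<delta>" "ratio_step (\<delta> 0) < c" "0 < j" for \<delta> and j :: int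
  proof -
    define n where "n = nat (j - 1)"
    have j: "j = int (Suc n)" using that by (simp add: n_def)
    have "0 \<le> ratio_step (\<delta> 0)"
      using that(1) ratio_step_nonneg less_imp_le unfolding ratio_orbit_def by blast
    have "\<delta> j = (ratio_step ^^ n) (ratio_step (\<delta> 0))"
      unfolding j ratio_orbit_funpow[OF that(1)] by (simp only: funpow_Suc_right o_apply)
    also have "\<dots> \<le> ratio_step (\<delta> 0) * (1 / 2) ^ n"
      by (rule funpow_ratio_step_le) fact
    also have "\<dots> \<le> ratio_step (\<delta> 0)"
      by (rule mult_left_le) (use \<open>0 \<le> ratio_step (\<delta> 0)\<close> in \<open>auto simp: power_le_one\<close>)
    finally show ?thesis using that by simp
  qed
  have "\<not> 0 < k" using below[OF \<gamma>(1,3), of k] eq[of 0] \<beta>(2) by auto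
  moreover have "\<not> k < 0" using below[OF \<beta>(1,3), of "- k"] eq[of "- k"] \<gamma>(2) by auto
  ultimately show ?thesis using eq[of 0] by auto
qed

section \<open>Product series along an orbit\<close>

definition orbit_weight :: "(real \<Rightarrow> real) \<Rightarrow> bool" where
  "orbit_weight f \<longleftrightarrow> continuous_on {0..} f \<and> mono_on {0..} f \<and> f 0 = 0"

text \<open>With \<open>f\<close> giving the ratio of consecutive increments, this is a one-sided
  total of increments in units of the first one.\<close>

definition orbit_series :: "(real \<Rightarrow> real) \<Rightarrow> real \<Rightarrow> real" where
  "orbit_series f y = (\<Sum>n. \<Prod>j<n. f ((ratio_step ^^ j) y))"

lemma orbit_weight_nonneg: "orbit_weight f \<Longrightarrow> 0 \<le> y \<Longrightarrow> 0 \<le> f y"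
  unfolding orbit_weight_def by (metis atLeast_iff mono_onD order_refl)

text \<open>Orbits tend to 0 and \<open>f\<close> is continuous with \<open>f 0 = 0\<close>, so the
  quotient of successive terms is eventually below 1/2.\<close>

lemma orbit_series_summable:
  assumes "orbit_weight f" "0 \<le> y"
  shows "summable (\<lambda>n. \<Prod>j<n. f ((ratio_step ^^ j) y))"
proof -
  have "(\<lambda>n. f ((ratio_step ^^ n) y)) \<longlonglongrightarrow> f 0"
    using assms funpow_ratio_step_nonneg
    by (intro continuous_on_tendsto_compose[of "{0..}" f] funpow_ratio_step_tendsto_0)
      (auto simp: orbit_weight_def)
  then have "\<forall>\<^sub>F n in sequentially. f ((ratio_step ^^ n) y) < 1 / 2"
    using assms by (intro order_tendstoD) (auto simp: orbit_weight_def)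
  then obtain N where N: "\<And>n. N \<le> n \<Longrightarrow> f ((ratio_step ^^ n) y) < 1 / 2"
    by (auto simp: eventually_sequentially)
  have nn: "0 \<le> f ((ratio_step ^^ n) y)" for n
    using assms by (simp add: orbit_weight_nonneg funpow_ratio_step_nonneg)
  show ?thesis
  proof (rule summable_ratio_test[of "1 / 2" N])
    fix n assume "N \<le> n"
    then show "norm (\<Prod>j<Suc n. f ((ratio_step ^^ j) y)) \<le> 1 / 2 * norm (\<Prod>j<n. f ((ratio_step ^^ j) y))"
      using mult_right_mono[of "f ((ratio_step ^^ n) y)" "1 / 2" "\<Prod>j<n. f ((ratio_step ^^ j) y)"]
        N[of n] nn by (simp add: prod_nonneg mult.commute abs_mult)
  qed simp
qed

lemma orbit_series_unfold:
  assumes "orbit_weight f" "0 \<le> y"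
  shows "orbit_series f y = 1 + f y * orbit_series f (ratio_step y)"
proof -
  have "orbit_series f y = (\<Sum>n. \<Prod>j<Suc n. f ((ratio_step ^^ j) y)) + 1"
    using suminf_split_head[OF orbit_series_summable[OF assms]] by (simp add: orbit_series_def)
  also have "(\<Sum>n. \<Prod>j<Suc n. f ((ratio_step ^^ j) y)) =
      (\<Sum>n. f y * (\<Prod>j<n. f ((ratio_step ^^ j) (ratio_step y))))"
    by (simp add: prod.lessThan_Suc_shift funpow_swap1 del: prod.lessThan_Suc)
  also have "\<dots> = f y * orbit_series f (ratio_step y)"
    unfolding orbit_series_def
    by (rule suminf_mult) (intro orbit_series_summable assms ratio_step_nonneg)
  finally show ?thesis by simp
qed

lemma orbit_series_ge_1:
  assumes "orbit_weight f" "0 \<le> y"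
  shows "1 \<le> orbit_series f y"
proof -
  have "(\<Sum>n<1. \<Prod>j<n. f ((ratio_step ^^ j) y)) \<le> orbit_series f y"
    unfolding orbit_series_def using assms
    by (intro sum_le_suminf orbit_series_summable)
      (auto intro!: prod_nonneg simp: orbit_weight_nonneg funpow_ratio_step_nonneg)
  then show ?thesis by simp
qed

text \<open>On \<open>{0..u}\<close> monotonicity of \<open>f\<close> and of the recursion bounds
  every term by its value at \<open>u\<close>, so the Weierstrass M-test applies; continuity on the
  half-line is then local.\<close>

lemma continuous_on_orbit_series:
  assumes "orbit_weight f"
  shows "continuous_on {0..} (orbit_series f)"
proof -
  have f: "continuous_on {0..} f" "mono_on {0..} f" using assms by (auto simp: orbit_weight_def)
  have "continuous_on {0..u} (orbit_series f)" if "0 \<le> u" for u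
  proof -
    have cont: "continuous_on {0..u} (\<lambda>y. f ((ratio_step ^^ j) y))" for j
      by (rule continuous_on_compose2[OF f(1) continuous_on_subset[OF continuous_on_funpow_ratio_step]])
        (auto simp: funpow_ratio_step_nonneg)
    have "uniform_limit {0..u} (\<lambda>N y. \<Sum>n<N. \<Prod>j<n. f ((ratio_step ^^ j) y)) (orbit_series f) sequentially"
      unfolding orbit_series_def
    proof (rule Weierstrass_m_test)
      show "summable (\<lambda>n. \<Prod>j<n. f ((ratio_step ^^ j) u))"
        by (rule orbit_series_summable) fact+
      fix n y assume y: "y \<in> {0..u}"
      have le: "0 \<le> f ((ratio_step ^^ j) y)" "f ((ratio_step ^^ j) y) \<le> f ((ratio_step ^^ j) u)" for j
        using y mono_onD[OF f(2)]
        by (auto simp: orbit_weight_nonneg[OF assms] funpow_ratio_step_nonneg funpow_ratio_step_mono)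
      then have "0 \<le> (\<Prod>j<n. f ((ratio_step ^^ j) y))"
        by (intro prod_nonneg) auto
      moreover have "(\<Prod>j<n. f ((ratio_step ^^ j) y)) \<le> (\<Prod>j<n. f ((ratio_step ^^ j) u))"
        using le by (intro prod_mono) auto
      ultimately show "norm (\<Prod>j<n. f ((ratio_step ^^ j) y)) \<le> (\<Prod>j<n. f ((ratio_step ^^ j) u))"
        by simp
    qed
    then show ?thesis
      by (rule uniform_limit_theorem[rotated]) (auto intro!: always_eventually continuous_intros cont)
  qed
  note cont = this
  show ?thesis
    unfolding continuous_on_eq_continuous_within
  proof
    fix y :: real assume "y \<in> {0..}"
    then have "0 \<le> y" by simp
    have "continuous (at y within {0..y + 1}) (orbit_series f)"
      using cont[of "y + 1"] \<open>0 \<le> y\<close>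
      by (auto simp: continuous_on_eq_continuous_within)
    moreover have "at y within {0..y + 1} = at y within {0..}"
      by (rule at_within_nhd[of _ "{..<y + 1}"]) auto
    ultimately show "continuous (at y within {0..}) (orbit_series f)" by simp
  qed
qed

text \<open>At a site with ratio \<open>z\<close> and Maxine's stake \<open>a\<close>, the
  increments of \<open>m\<close> on the left and right are \<open>a / z\<close> and
  \<open>a * (2 + z)\<close>. Their quotient, right over left, is \<open>up_weight z\<close>; the
  reciprocal is \<open>down_weight (inverse z)\<close>.\<close>

definition up_weight :: "real \<Rightarrow> real" where "up_weight y = y * (2 + y)"
definition down_weight :: "real \<Rightarrow> real" where "down_weight y = y\<^sup>2 / (1 + 2 * y)"

lemma orbit_weight_up_weight: "orbit_weight up_weight"
  unfolding orbit_weight_def up_weight_def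
  by (auto intro!: continuous_intros mono_onI mult_mono)

lemma orbit_weight_down_weight: "orbit_weight down_weight"
  unfolding orbit_weight_def
proof safe
  show "continuous_on {0..} down_weight"
    unfolding down_weight_def by (intro continuous_intros) auto
  show "mono_on {0..} down_weight"
  proof (rule mono_onI)
    fix y z :: real assume "y \<in> {0..}" "z \<in> {0..}" "y \<le> z"
    then have "y * y \<le> z * z" "y * y * z \<le> z * z * y"
      using mult_left_mono[of y z "y * z"] by (auto intro: mult_mono simp: mult_ac)
    then show "down_weight y \<le> down_weight z"
      unfolding down_weight_def using \<open>y \<in> {0..}\<close> \<open>z \<in> {0..}\<close>
      by (simp add: frac_le_eq divide_simps power2_eq_square algebra_simps)
  qed
qed (simp add: down_weight_def)

section \<open>The margin of an orbit\<close>

text \<open>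
  In a solution with \<open>\<beta>\<^sub>i = y\<close> the increments of \<open>m\<close> adjacent to \<open>i\<close> are \<open>m\<^sub>i\<^sub>+\<^sub>1 - m\<^sub>i = a\<^sub>i (2 + y)\<close> and
  \<open>m\<^sub>i - m\<^sub>i\<^sub>-\<^sub>1 = a\<^sub>i / y\<close>, and consecutive increments have the ratios \<open>up_weight\<close> (to the right) and
  \<open>down_weight\<close> at the inverted orbit (to the left). So \<open>right_sum y\<close> is \<open>(m\<^sub>\<infinity> - m\<^sub>i) / a\<^sub>i\<close> and \<open>left_sum y\<close>
  is \<open>(m\<^sub>i - m\<^sub>-\<^sub>\<infinity>) / a\<^sub>i\<close>.
\<close>

definition right_sum :: "real \<Rightarrow> real" where
  "right_sum y = (2 + y) * orbit_series up_weight (ratio_step y)"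

definition left_sum :: "real \<Rightarrow> real" where
  "left_sum y = inverse y * orbit_series down_weight (ratio_step (inverse y))"

definition full_sum :: "real \<Rightarrow> real" where
  "full_sum y = right_sum y + left_sum y"

lemma right_sum_ge:
  assumes "0 < y"
  shows "2 + y \<le> right_sum y"
  unfolding right_sum_def
  using orbit_series_ge_1[OF orbit_weight_up_weight, of "ratio_step y"] ratio_step_pos[OF assms] assms
  by (simp add: mult_le_cancel_left1)

lemma left_sum_ge:
  assumes "0 < y"
  shows "inverse y \<le> left_sum y"
  unfolding left_sum_def
  using orbit_series_ge_1[OF orbit_weight_down_weight, of "ratio_step (inverse y)"]
    ratio_step_pos[of "inverse y"] assms
  by (simp add: mult_le_cancel_left1)

lemma left_sum_pos: "0 < y \<Longrightarrow> 0 < left_sum y"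
  using left_sum_ge[of y] by (meson less_le_trans positive_imp_inverse_positive)

lemma full_sum_pos: "0 < y \<Longrightarrow> 0 < full_sum y"
  using right_sum_ge[of y] left_sum_pos[of y] by (simp add: full_sum_def)

text \<open>Moving the base point one site to the right takes the increment \<open>2 + y\<close> out
  of the right sum. The factor \<open>(2 + y) * ratio_step y\<close> is the quotient of Maxine's
  stakes at the two sites and converts the units.\<close>

lemma right_sum_step:
  assumes "0 < y"
  shows "(2 + y) * (ratio_step y * right_sum (ratio_step y)) = right_sum y - (2 + y)"
proof -
  have "right_sum y = (2 + y) * (1 + up_weight (ratio_step y) * orbit_series up_weight (ratio_step (ratio_step y)))"
    unfolding right_sum_def[of y] using assms ratio_step_pos[OF assms]
    by (subst orbit_series_unfold[OF orbit_weight_up_weight]) auto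
  then show ?thesis by (simp add: right_sum_def up_weight_def algebra_simps)
qed

text \<open>The same move adds the increment to the left sum; the series unfolds at
  \<open>inverse y\<close>, to which \<open>ratio_step_inverse\<close> leads back.\<close>

lemma left_sum_step:
  assumes "0 < y"
  shows "(2 + y) * (ratio_step y * left_sum (ratio_step y)) = left_sum y + (2 + y)"
proof -
  have z: "0 < ratio_step y" using assms by (rule ratio_step_pos)
  have "ratio_step y * left_sum (ratio_step y) = orbit_series down_weight (inverse y)"
    using z by (simp add: left_sum_def ratio_step_inverse assms)
  also have "\<dots> = 1 + down_weight (inverse y) * orbit_series down_weight (ratio_step (inverse y))"
    using assms by (subst orbit_series_unfold[OF orbit_weight_down_weight]) auto
  also have "down_weight (inverse y) = inverse y / (2 + y)"
    using assms by (simp add: down_weight_def field_simps power2_eq_square)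
  finally have unfold: "ratio_step y * left_sum (ratio_step y) =
      1 + inverse y / (2 + y) * orbit_series down_weight (ratio_step (inverse y))" .
  have "(2 + y) * (1 + s / (2 + y) * t) = s * t + (2 + y)" for s t
    using assms by (simp add: field_simps)
  then show ?thesis
    unfolding unfold left_sum_def[of y] .
qed

text \<open>What the right sum loses the left sum gains: the total gap of \<open>m\<close> does not
  depend on the base point.\<close>

lemma full_sum_step:
  assumes "0 < y"
  shows "(2 + y) * (ratio_step y * full_sum (ratio_step y)) = full_sum y"
  using right_sum_step[OF assms] left_sum_step[OF assms]
  by (simp add: full_sum_def distrib_left)

text \<open>Maxine's value at a site with ratio \<open>y\<close>, rescaled affinely to run from 0 to
  1.\<close>

definition rel_value :: "real \<Rightarrow> real" where
  "rel_value y = left_sum y / full_sum y"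

text \<open>Maxine's gap is \<open>a * full_sum y\<close> and, by reflection, Mina's is
  \<open>b * full_sum (inverse y)\<close>; with \<open>y = b / a\<close> this is their
  quotient.\<close>

definition orbit_margin :: "real \<Rightarrow> real" where
  "orbit_margin y = y * full_sum (inverse y) / full_sum y"

lemma rel_value_step:
  assumes "0 < y"
  shows "rel_value (ratio_step y) = rel_value y + (2 + y) / full_sum y"
proof -
  have z: "0 < ratio_step y" using assms by (rule ratio_step_pos)
  have "rel_value (ratio_step y) =
      ((2 + y) * (ratio_step y * left_sum (ratio_step y))) / ((2 + y) * (ratio_step y * full_sum (ratio_step y)))"
    using assms z by (simp add: rel_value_def)
  also have "\<dots> = (left_sum y + (2 + y)) / full_sum y"
    by (simp only: left_sum_step full_sum_step assms)
  finally show ?thesis by (simp add: rel_value_def add_divide_distrib)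
qed

text \<open>The same increment measured from its right end, as required for the value one site to
  the left.\<close>

lemma rel_value_step':
  assumes "0 < y"
  shows "rel_value (ratio_step y) = rel_value y + 1 / (ratio_step y * full_sum (ratio_step y))"
  using assms ratio_step_pos[OF assms] full_sum_pos[OF ratio_step_pos[OF assms]]
  unfolding rel_value_step[OF assms] full_sum_step[OF assms, symmetric] by simp

lemma orbit_margin_pos: "0 < y \<Longrightarrow> 0 < orbit_margin y"
  by (simp add: orbit_margin_def full_sum_pos)

lemma orbit_margin_inverse: "0 < y \<Longrightarrow> orbit_margin (inverse y) = inverse (orbit_margin y)"
  by (simp add: orbit_margin_def field_simps)

lemma orbit_margin_step:
  assumes "0 < y"
  shows "orbit_margin (ratio_step y) = orbit_margin y"
proof -
  define z where "z = ratio_step y"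
  have z: "0 < z" unfolding z_def using assms by (rule ratio_step_pos)
  have q: "z * (1 + 2 * z) * (2 + y) = y * y"
    using ratio_step_eq[of y] assms by (simp add: z_def power2_eq_square)
  have 1: "(2 + y) * (z * full_sum z) = full_sum y"
    using full_sum_step[OF assms] by (simp add: z_def)
  \<comment> \<open>The reflected orbit steps from \<open>inverse z\<close> to
    \<open>inverse y\<close>, so Mina's gap is conserved as well. The defining equation of
    \<open>z\<close> then cancels the remaining factors.\<close>
  have 2: "(2 + inverse z) * (inverse y * full_sum (inverse y)) = full_sum (inverse z)"
    using full_sum_step[of "inverse z"] z ratio_step_inverse[OF assms] by (simp add: z_def)
  have "orbit_margin z = (z * (2 + inverse z)) * (inverse y * full_sum (inverse y)) / full_sum z"
    unfolding orbit_margin_def 2[symmetric] by simp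
  also have "z * (2 + inverse z) = 1 + 2 * z" using z by (simp add: field_simps)
  also have "(1 + 2 * z) * (inverse y * full_sum (inverse y)) / full_sum z =
      (z * (1 + 2 * z) * (2 + y)) * (inverse y * full_sum (inverse y)) / ((2 + y) * (z * full_sum z))"
    using z assms by (simp add: divide_simps)
  also have "\<dots> = orbit_margin y"
    unfolding q 1 orbit_margin_def using assms by simp
  finally show ?thesis by (simp add: z_def)
qed

lemma continuous_on_orbit_margin: "continuous_on {0<..} orbit_margin"
proof -
  have series: "continuous_on {0<..} (\<lambda>y. orbit_series f (ratio_step (g y)))"
    if "orbit_weight f" "continuous_on {0<..} g" "\<And>y. 0 < y \<Longrightarrow> 0 < g y" for f and g :: "real \<Rightarrow> real"
  proof -
    have g: "0 \<le> g y" if "0 < y" for y using \<open>\<And>y. 0 < y \<Longrightarrow> 0 < g y\<close>[OF that] by simp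
    have "continuous_on {0<..} (\<lambda>y. ratio_step (g y))"
      by (rule continuous_on_compose2[OF continuous_on_ratio_step that(2)]) (auto simp: g)
    then show ?thesis
      by (rule continuous_on_compose2[OF continuous_on_orbit_series[OF that(1)]])
        (auto simp: g ratio_step_nonneg)
  qed
  have up: "continuous_on {0<..} (\<lambda>y. orbit_series up_weight (ratio_step y))"
    by (rule series[OF orbit_weight_up_weight]) auto
  have down: "continuous_on {0<..} (\<lambda>y. orbit_series down_weight (ratio_step (inverse y)))"
    by (rule series[OF orbit_weight_down_weight]) (auto intro: continuous_on_inverse)
  have full: "continuous_on {0<..} full_sum"
    unfolding full_sum_def right_sum_def left_sum_def
    by (intro continuous_on_add continuous_on_mult continuous_on_const continuous_on_id
        continuous_on_inverse up down) auto
  have "continuous_on {0<..} (\<lambda>y. full_sum (inverse y))"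
    by (rule continuous_on_compose2[OF full]) (auto intro: continuous_on_inverse)
  then show ?thesis
    unfolding orbit_margin_def
    by (intro continuous_on_divide continuous_on_mult continuous_on_id full)
      (auto dest: full_sum_pos)
qed

lemma orbit_series_tendsto_at_0:
  assumes "orbit_weight f"
  shows "((\<lambda>y. orbit_series f (ratio_step y)) \<longlongrightarrow> orbit_series f 0) (at_right 0)"
proof -
  have "continuous_on {0..} (\<lambda>y. orbit_series f (ratio_step y))"
    by (rule continuous_on_compose2[OF continuous_on_orbit_series[OF assms] continuous_on_ratio_step])
      (auto simp: ratio_step_nonneg)
  then have "((\<lambda>y. orbit_series f (ratio_step y)) \<longlongrightarrow> orbit_series f 0) (at 0 within {0..})"
    by (auto simp: continuous_on_def dest: bspec[where x = 0])
  then show ?thesis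
    by (rule tendsto_mono[rotated]) (rule at_le, auto)
qed

text \<open>The complement \<open>right_sum y / full_sum y\<close> is at most
  \<open>right_sum y * y\<close>, because the left sum alone is at least \<open>inverse y\<close>,
  and \<open>right_sum\<close> stays bounded near 0.\<close>

lemma rel_value_tendsto_1: "(rel_value \<longlongrightarrow> 1) (at_right 0)"
proof -
  have "((\<lambda>y. right_sum y * y) \<longlongrightarrow> ((2 + 0) * orbit_series up_weight 0) * 0) (at_right 0)"
    unfolding right_sum_def
    by (intro tendsto_intros orbit_series_tendsto_at_0 orbit_weight_up_weight)
  then have lim: "((\<lambda>y. 1 - right_sum y * y) \<longlongrightarrow> 1 - 0) (at_right 0)"
    by (intro tendsto_diff tendsto_const) simp
  have ev: "\<forall>\<^sub>F y in at_right 0. 0 < (y::real)"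
    by (simp add: eventually_at_right_less)
  show ?thesis
  proof (rule tendsto_sandwich[OF _ _ lim[simplified] tendsto_const])
    show "\<forall>\<^sub>F y in at_right 0. 1 - right_sum y * y \<le> rel_value y"
      using ev
    proof eventually_elim
      case (elim y)
      have "1 - rel_value y = right_sum y / full_sum y"
        using full_sum_pos[OF elim] by (simp add: rel_value_def full_sum_def field_simps)
      also have "\<dots> \<le> right_sum y / inverse y"
        using elim right_sum_ge[OF elim] left_sum_ge[OF elim]
        by (intro divide_left_mono) (auto simp: full_sum_def intro!: mult_pos_pos add_pos_pos left_sum_pos)
      finally show ?case by (simp add: divide_inverse)
    qed
    show "\<forall>\<^sub>F y in at_right 0. rel_value y \<le> 1"
      using ev
    proof eventually_elim
      case (elim y)
      then show ?case
        using full_sum_pos[OF elim] right_sum_ge[OF elim] by (simp add: rel_value_def full_sum_def)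
    qed
  qed
qed

text \<open>The left sum vanishes at infinity, while the right sum keeps \<open>full_sum\<close>
  above 1.\<close>

lemma rel_value_tendsto_0: "(rel_value \<longlongrightarrow> 0) at_top"
proof -
  have "((\<lambda>y. left_sum y) \<longlongrightarrow> 0 * orbit_series down_weight 0) at_top"
    unfolding left_sum_def
    by (intro tendsto_mult tendsto_inverse_0_at_top filterlim_ident
        filterlim_compose[OF orbit_series_tendsto_at_0[OF orbit_weight_down_weight]]
        filterlim_inverse_at_right_top)
  then have lim: "((\<lambda>y. left_sum y) \<longlongrightarrow> 0) at_top" by simp
  show ?thesis
  proof (rule tendsto_sandwich[OF _ _ tendsto_const lim])
    show "\<forall>\<^sub>F y in at_top. 0 \<le> rel_value y"
      using eventually_gt_at_top[of 0]
      by eventually_elim (simp add: rel_value_def left_sum_pos full_sum_pos less_imp_le)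
    show "\<forall>\<^sub>F y in at_top. rel_value y \<le> left_sum y"
      using eventually_gt_at_top[of 0]
    proof eventually_elim
      case (elim y)
      have "1 \<le> full_sum y"
        using elim right_sum_ge[OF elim] left_sum_pos[OF elim] by (simp add: full_sum_def)
      then show ?case
        using left_sum_pos[OF elim] by (simp add: rel_value_def divide_le_eq mult_le_cancel_left1)
    qed
  qed
qed

lemma ratio_orbit_margin:
  assumes "ratio_orbit \<beta>"
  shows "orbit_margin (\<beta> i) = orbit_margin (\<beta> 0)"
  by (rule int_shift_invariant) (use assms orbit_margin_step in \<open>auto simp: ratio_orbit_def\<close>)

section \<open>ABMN solutions\<close>

text \<open>Given the stakes, the equations at a site are linear in the neighbouring values; solving
  them expresses each increment through the stakes alone.\<close>

lemma abmn_differences: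
  assumes "abmn_positive a b m n"
  shows "0 < a i" "0 < b i"
    and "m i - m (i - 1) = (a i)\<^sup>2 / b i" "m (i + 1) - m i = 2 * a i + b i"
    and "n i - n (i + 1) = (b i)\<^sup>2 / a i" "n (i - 1) - n i = 2 * b i + a i"
proof -
  have eqs: "0 < a i" "0 < b i"
    "(a i + b i) * (m i + a i) = a i * m (i+1) + b i * m (i-1)"
    "(a i + b i) * (n i + b i) = a i * n (i+1) + b i * n (i-1)"
    "(a i + b i)^2 = b i * (m (i+1) - m (i-1))"
    "(a i + b i)^2 = a i * (n (i-1) - n (i+1))"
    using assms unfolding abmn_positive_def by blast+
  \<comment> \<open>One player's two equations: \<open>s\<close> is the own stake, \<open>r\<close>
    the opponent's, \<open>hi\<close> the value at the favourable neighbour. For Mina that neighbour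
    is \<open>i - 1\<close>.\<close>
  have lin: "lo = (mid::real) - s\<^sup>2 / r \<and> hi = mid + 2 * s + r"
    if "0 < s" "0 < r" "(s + r) * (mid + s) = s * hi + r * lo" "(s + r)^2 = r * (hi - lo)" for s r lo mid hi
  proof -
    have hi: "hi = lo + (s + r)\<^sup>2 / r" using that by (simp add: field_simps)
    have "(s + r) * (mid + s) = (s + r) * (lo + s * (s + r) / r)"
      unfolding that(3) hi using that(1,2) by (simp add: field_simps power2_eq_square)
    then have "mid + s = lo + s * (s + r) / r" using that(1,2) by simp
    moreover have "(s + r)\<^sup>2 / r = s\<^sup>2 / r + 2 * s + r" "s * (s + r) / r = s\<^sup>2 / r + s"
      using that(2) by (simp_all add: field_simps power2_eq_square)
    ultimately show ?thesis using hi by simp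
  qed
  show "0 < a i" "0 < b i" by fact+
  show "m i - m (i - 1) = (a i)\<^sup>2 / b i" "m (i + 1) - m i = 2 * a i + b i"
    using lin[OF eqs(1,2,3,5)] by auto
  show "n i - n (i + 1) = (b i)\<^sup>2 / a i" "n (i - 1) - n i = 2 * b i + a i"
    using lin[of "b i" "a i" "n i" "n (i - 1)" "n (i + 1)"] eqs by (auto simp: ac_simps)
qed

text \<open>Each increment of \<open>m\<close> and of \<open>n\<close> is computed from both of its
  end sites. Equating the results relates consecutive stakes, and dividing the two relations leaves
  the recursion for the ratio.\<close>

lemma abmn_ratio_orbit:
  assumes "abmn_positive a b m n"
  shows "ratio_orbit (\<lambda>i. b i / a i)"
    and "a (i + 1) = b (i + 1) / a (i + 1) * (2 + b i / a i) * a i"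
proof -
  note d = abmn_differences[OF assms]
  have 1: "(a (i + 1))\<^sup>2 / b (i + 1) = 2 * a i + b i" for i
    using d(3)[of "i + 1"] d(4)[of i] by simp
  have 2: "(b i)\<^sup>2 / a i = 2 * b (i + 1) + a (i + 1)" for i
    using d(5)[of "i"] d(6)[of "i + 1"] by simp
  show "a (i + 1) = b (i + 1) / a (i + 1) * (2 + b i / a i) * a i"
    using 1[of i] d(1,2)[of i] d(1,2)[of "i + 1"] by (simp add: field_simps power2_eq_square)
  have "ratio_step (b i / a i) = b (i + 1) / a (i + 1)" for i
  proof (rule ratio_step_eqI)
    have "b (i + 1) / a (i + 1) * (1 + 2 * (b (i + 1) / a (i + 1))) =
        (2 * b (i + 1) + a (i + 1)) / ((a (i + 1))\<^sup>2 / b (i + 1))"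
      using d(1,2)[of "i + 1"] by (simp add: field_simps power2_eq_square)
    also have "\<dots> = (b i / a i)\<^sup>2 / (2 + b i / a i)"
      unfolding 1 2[symmetric] using d(1,2)[of i] by (simp add: field_simps power2_eq_square)
    finally show "b (i + 1) / a (i + 1) * (1 + 2 * (b (i + 1) / a (i + 1))) =
        (b i / a i)\<^sup>2 / (2 + b i / a i)" .
  qed (use d(1,2) in \<open>auto simp: less_imp_le\<close>)
  then show "ratio_orbit (\<lambda>i. b i / a i)"
    using d(1,2) by (simp add: ratio_orbit_def)
qed

text \<open>Both \<open>a i * full_sum (b i / a i)\<close> and
  \<open>m i - a i * left_sum (b i / a i)\<close> are conserved. Hence \<open>m\<close> is an affine
  function of \<open>rel_value\<close> along the orbit, whose limits are 0 and 1.\<close>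

lemma abmn_maxine_gap:
  assumes "abmn_positive a b m n"
  shows "Lim at_top m - Lim at_bot m = a 0 * full_sum (b 0 / a 0)"
proof -
  define \<beta> where "\<beta> i = b i / a i" for i
  have orb: "ratio_orbit \<beta>" and a: "\<And>i. a (i + 1) = \<beta> (i + 1) * (2 + \<beta> i) * a i"
    unfolding \<beta>_def using abmn_ratio_orbit[OF assms] by auto
  note d = abmn_differences[OF assms]
  have pos: "0 < \<beta> i" and step: "\<beta> (i + 1) = ratio_step (\<beta> i)" for i
    using orb by (auto simp: ratio_orbit_def)
  define C where "C = a 0 * full_sum (\<beta> 0)"
  have C: "a i * full_sum (\<beta> i) = C" for i
    unfolding C_def
  proof (rule int_shift_invariant)
    fix i
    have "a (i + 1) * full_sum (\<beta> (i + 1)) = a i * ((2 + \<beta> i) * (\<beta> (i + 1) * full_sum (\<beta> (i + 1))))"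
      by (subst a) (simp add: ac_simps)
    then show "a (i + 1) * full_sum (\<beta> (i + 1)) = a i * full_sum (\<beta> i)"
      using full_sum_step[OF pos[of i]] by (simp add: step)
  qed
  define D where "D = m 0 - a 0 * left_sum (\<beta> 0)"
  have D: "m i - a i * left_sum (\<beta> i) = D" for i
    unfolding D_def
  proof (rule int_shift_invariant[of "\<lambda>i. m i - a i * left_sum (\<beta> i)"])
    fix i
    have "a (i + 1) * left_sum (\<beta> (i + 1)) = a i * ((2 + \<beta> i) * (\<beta> (i + 1) * left_sum (\<beta> (i + 1))))"
      by (subst a) (simp add: ac_simps)
    also have "\<dots> = a i * left_sum (\<beta> i) + a i * (2 + \<beta> i)"
      using left_sum_step[OF pos[of i]] by (simp add: step distrib_left)
    also have "a i * (2 + \<beta> i) = m (i + 1) - m i"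
      using d(1)[of i] d(4)[of i] by (simp add: \<beta>_def distrib_left)
    finally show "m (i + 1) - a (i + 1) * left_sum (\<beta> (i + 1)) = m i - a i * left_sum (\<beta> i)" by simp
  qed
  have m: "m i = D + C * rel_value (\<beta> i)" for i
    using D[of i] C[of i] full_sum_pos[OF pos[of i]] by (simp add: rel_value_def field_simps)
  have "(m \<longlongrightarrow> D + C * 1) at_top"
    unfolding m by (intro tendsto_intros filterlim_compose[OF rel_value_tendsto_1 ratio_orbit_at_top[OF orb]])
  moreover have "(m \<longlongrightarrow> D + C * 0) at_bot"
    unfolding m by (intro tendsto_intros filterlim_compose[OF rel_value_tendsto_0 ratio_orbit_at_bot[OF orb]])
  ultimately have "Lim at_top m = D + C" "Lim at_bot m = D"
    using tendsto_Lim trivial_limit_at_top_linorder trivial_limit_at_bot_linorder by fastforce+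
  then show ?thesis by (simp add: C_def \<beta>_def)
qed

lemma tendsto_reflect_int:
  fixes f :: "int \<Rightarrow> real"
  shows "(f \<longlongrightarrow> L) at_top \<Longrightarrow> ((\<lambda>i. f (- i)) \<longlongrightarrow> L) at_bot"
    and "(f \<longlongrightarrow> L) at_bot \<Longrightarrow> ((\<lambda>i. f (- i)) \<longlongrightarrow> L) at_top"
  using filterlim_compose filterlim_uminus_int by blast+

text \<open>Reversing the axis exchanges the players, so Mina's gap is obtained from the result on
  Maxine's.\<close>

lemma abmn_reflect:
  assumes "abmn_positive a b m n"
  shows "abmn_positive (\<lambda>i. b (- i)) (\<lambda>i. a (- i)) (\<lambda>i. n (- i)) (\<lambda>i. m (- i))"
  unfolding abmn_positive_def
proof (intro conjI allI)
  fix i :: int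
  note eqs = assms[unfolded abmn_positive_def, THEN conjunct1, rule_format, of "- i"]
  have neg: "- (i + 1) = - i - 1" "- (i - 1) = - i + 1" by linarith+
  show "0 < b (- i)" "0 < a (- i)" using eqs by auto
  show "(b (- i) + a (- i)) * (n (- i) + b (- i)) = b (- i) * n (- (i + 1)) + a (- i) * n (- (i - 1))"
    "(b (- i) + a (- i)) * (m (- i) + a (- i)) = b (- i) * m (- (i + 1)) + a (- i) * m (- (i - 1))"
    "(b (- i) + a (- i))\<^sup>2 = a (- i) * (n (- (i + 1)) - n (- (i - 1)))"
    "(b (- i) + a (- i))\<^sup>2 = b (- i) * (m (- (i - 1)) - m (- (i + 1)))"
    unfolding neg add.commute[of "b (- i)" "a (- i)"] add.commute[of "b (- i) * _"] using eqs by blast+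
qed (use assms in \<open>auto simp: abmn_positive_def intro: tendsto_reflect_int\<close>)

lemma mina_margin_abmn:
  assumes "abmn_positive a b m n"
  shows "mina_margin m n = orbit_margin (b 0 / a 0)"
proof -
  obtain L L' where L: "(n \<longlongrightarrow> L) at_bot" "(n \<longlongrightarrow> L') at_top"
    using assms by (auto simp: abmn_positive_def)
  have "Lim at_top (\<lambda>i. n (- i)) = L" "Lim at_bot (\<lambda>i. n (- i)) = L'" "Lim at_top n = L'" "Lim at_bot n = L"
    using L tendsto_reflect_int tendsto_Lim trivial_limit_at_top_linorder trivial_limit_at_bot_linorder
    by blast+
  then have "Lim at_bot n - Lim at_top n = b 0 * full_sum (a 0 / b 0)"
    using abmn_maxine_gap[OF abmn_reflect[OF assms]] by simp
  then show ?thesis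
    unfolding mina_margin_def abmn_maxine_gap[OF assms] orbit_margin_def by (simp add: divide_simps)
qed

text \<open>Normalising Maxine's limits to 0 and 1 forces \<open>a\<close> and \<open>m\<close>. The
  reflected formula gives \<open>n\<close> up to scale, and the one scale \<open>x\<close> fits
  every site because the margin is constant along the orbit.\<close>

lemma abmn_from_orbit:
  assumes "ratio_orbit \<beta>" and x: "orbit_margin (\<beta> 0) = x"
  defines "a \<equiv> \<lambda>i. inverse (full_sum (\<beta> i))"
  defines "b \<equiv> \<lambda>i. \<beta> i * a i"
  defines "m \<equiv> \<lambda>i. rel_value (\<beta> i)"
  defines "n \<equiv> \<lambda>i. x * rel_value (inverse (\<beta> i))"
  shows "abmn_positive a b m n"
    and "(m \<longlongrightarrow> 0) at_bot" "(m \<longlongrightarrow> 1) at_top" "(n \<longlongrightarrow> x) at_bot" "(n \<longlongrightarrow> 0) at_top"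
proof -
  show lims: "(m \<longlongrightarrow> 0) at_bot" "(m \<longlongrightarrow> 1) at_top"
    unfolding m_def
    using filterlim_compose[OF rel_value_tendsto_1 ratio_orbit_at_top[OF assms(1)]]
      filterlim_compose[OF rel_value_tendsto_0 ratio_orbit_at_bot[OF assms(1)]] by auto
  have "((\<lambda>i. x * rel_value (inverse (\<beta> i))) \<longlongrightarrow> x * 1) at_bot"
    by (intro tendsto_intros filterlim_compose[OF rel_value_tendsto_1]
        filterlim_compose[OF filterlim_inverse_at_right_top] ratio_orbit_at_bot[OF assms(1)])
  moreover have "((\<lambda>i. x * rel_value (inverse (\<beta> i))) \<longlongrightarrow> x * 0) at_top"
    by (intro tendsto_intros filterlim_compose[OF rel_value_tendsto_0]
        filterlim_compose[OF filterlim_inverse_at_top_right] ratio_orbit_at_top[OF assms(1)])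
  ultimately show limn: "(n \<longlongrightarrow> x) at_bot" "(n \<longlongrightarrow> 0) at_top"
    unfolding n_def by simp_all
  show "abmn_positive a b m n"
    unfolding abmn_positive_def
  proof (intro conjI allI)
    fix i
    define y where "y = \<beta> i"
    have y: "0 < y" and succ: "\<beta> (i + 1) = ratio_step y"
      using assms(1) by (auto simp: ratio_orbit_def y_def)
    have w: "0 < \<beta> (i - 1)" and pred: "y = ratio_step (\<beta> (i - 1))"
      using assms(1)[unfolded ratio_orbit_def, rule_format, of "i - 1"] by (auto simp: y_def)
    have pred': "inverse (\<beta> (i - 1)) = ratio_step (inverse y)"
      unfolding pred using ratio_step_inverse[OF w] by simp
    have succ': "ratio_step (inverse (\<beta> (i + 1))) = inverse y"
      unfolding succ using ratio_step_inverse[OF y] by simp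
    have T: "0 < full_sum y" "0 < full_sum (inverse y)" using y full_sum_pos by auto
    have x': "x = y * full_sum (inverse y) / full_sum y"
      using ratio_orbit_margin[OF assms(1), of i] x by (simp add: y_def orbit_margin_def)
    have a: "a i = inverse (full_sum y)" "0 < a i" and b: "b i = y * a i" "0 < b i"
      using T y by (auto simp: a_def b_def y_def)
    have m1: "m (i + 1) = m i + a i * (2 + y)"
      using rel_value_step[OF y] a by (simp add: m_def succ y_def[symmetric] divide_inverse mult.commute)
    have m2: "m (i - 1) = m i - a i / y"
      using rel_value_step'[OF w] a by (simp add: m_def pred[symmetric] y_def[symmetric] divide_inverse mult.commute)
    have n1: "n (i - 1) = n i + a i * (1 + 2 * y)"
    proof -
      have "n (i - 1) - n i = x * ((2 + inverse y) / full_sum (inverse y))"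
        using rel_value_step[of "inverse y"] y by (simp add: n_def pred' y_def[symmetric] distrib_left)
      also have "\<dots> = a i * (1 + 2 * y)"
        unfolding x' a(1) using y T by (simp add: field_simps)
      finally show ?thesis by simp
    qed
    have n2: "n (i + 1) = n i - a i * y\<^sup>2"
    proof -
      have "n i - n (i + 1) = x * (1 / (inverse y * full_sum (inverse y)))"
        using rel_value_step'[of "inverse (\<beta> (i + 1))"] y ratio_step_pos[OF y]
        by (simp add: n_def succ' y_def[symmetric] distrib_left) (simp add: succ distrib_left)
      also have "\<dots> = a i * y\<^sup>2"
        unfolding x' a(1) using y T by (simp add: field_simps power2_eq_square)
      finally show ?thesis by simp
    qed
    show "0 < a i" "0 < b i" by fact+
    show "(a i + b i) * (m i + a i) = a i * m (i + 1) + b i * m (i - 1)"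
      "(a i + b i) * (n i + b i) = a i * n (i + 1) + b i * n (i - 1)"
      "(a i + b i)\<^sup>2 = b i * (m (i + 1) - m (i - 1))"
      "(a i + b i)\<^sup>2 = a i * (n (i - 1) - n (i + 1))"
      unfolding m1 m2 n1 n2 b(1) using y by (simp_all add: field_simps power2_eq_square)
  qed (use lims limn in auto)
qed

text \<open>The margin is continuous and invariant under one step of the orbit, so it lives on a circle;
  a value strictly between two others is therefore attained on both arcs joining them.\<close>

lemma orbit_margin_attained_twice:
  assumes u: "0 < u" "orbit_margin u < x" and v: "0 < v" "x < orbit_margin v"
  obtains y z where "u < y" "y < z" "ratio_step z < u" "orbit_margin y = x" "orbit_margin z = x"
proof -
  obtain \<beta> where \<beta>: "ratio_orbit \<beta>" "\<beta> 0 = v"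
    using ratio_orbit_exists[OF v(1)] by blast
  have pos: "0 < \<beta> i" and step: "\<beta> (i + 1) = ratio_step (\<beta> i)" for i
    using \<beta>(1) by (auto simp: ratio_orbit_def)
  \<comment> \<open>The orbit runs from infinity down to 0 and so crosses \<open>u\<close>. This
    moves \<open>v\<close> into the period starting at \<open>u\<close> without changing its
    margin.\<close>
  have "\<exists>i. u \<le> \<beta> i \<and> \<beta> (i + 1) < u"
  proof (rule ccontr)
    assume "\<not> ?thesis"
    then have up: "u \<le> \<beta> (i + 1)" if "u \<le> \<beta> i" for i using that by force
    obtain j where j: "u \<le> \<beta> j"
      using ratio_orbit_at_bot[OF \<beta>(1)] unfolding filterlim_at_top eventually_at_bot_linorder by blast
    have "u \<le> \<beta> i" if "j \<le> i" for i
      using that by (induction i rule: int_ge_induct) (auto simp: j up)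
    moreover have "(\<beta> \<longlongrightarrow> 0) at_top"
      using ratio_orbit_at_top[OF \<beta>(1)] by (simp add: filterlim_at)
    then have "\<forall>\<^sub>F i in at_top. \<beta> i < u" using u(1) by (rule order_tendstoD)
    then have "\<exists>i\<ge>j. \<beta> i < u"
      by (metis eventually_at_top_linorder linorder_le_cases)
    ultimately show False by (meson not_le)
  qed
  then obtain i where i: "u \<le> \<beta> i" "ratio_step (\<beta> i) < u" by (auto simp: step)
  define w where "w = \<beta> i"
  have w: "x < orbit_margin w" "u < w" "ratio_step w < u"
    using ratio_orbit_margin[OF \<beta>(1), of i] \<beta>(2) v i u(2) by (auto simp: w_def order_less_le)
  \<comment> \<open>The preimage of \<open>u\<close>: \<open>{u..u'}\<close> is one full period,
    with equal margins below \<open>x\<close> at its ends and a margin above \<open>x\<close> at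
    \<open>w\<close> inside.\<close>
  define u' where "u' = inverse (ratio_step (inverse u))"
  have u': "0 < u'" "ratio_step u' = u"
    using u(1) ratio_step_pos[of "inverse u"] ratio_step_inverse[of "inverse u"] by (auto simp: u'_def)
  have "orbit_margin u' < x" using orbit_margin_step[OF u'(1)] u' u by simp
  have "w < u'" using ratio_step_mono[of u' w] u' w by fastforce
  have cont: "continuous_on {s..t} orbit_margin" if "0 < s" for s t
    by (rule continuous_on_subset[OF continuous_on_orbit_margin]) (use that in auto)
  obtain y where y: "u \<le> y" "y \<le> w" "orbit_margin y = x"
    using IVT'[of orbit_margin u x w] u w cont[of u w] by auto
  obtain z where z: "w \<le> z" "z \<le> u'" "orbit_margin z = x"
    using IVT2'[of orbit_margin u' x w] u w cont[of w u'] \<open>w < u'\<close> \<open>orbit_margin u' < x\<close> by auto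
  have "u < y" "y < w" "w < z" "z < u'"
    using y z u w \<open>orbit_margin u' < x\<close> by (auto simp: order_less_le)
  moreover have "ratio_step z < u"
    using ratio_step_strict_mono[of z u'] \<open>w < z\<close> \<open>z < u'\<close> w u u' by simp
  ultimately show ?thesis using that[of y z] y z by simp
qed

section \<open>Expected payoffs by first-step analysis\<close>

abbreviation unif :: "real measure" where
  "unif \<equiv> uniform_measure lborel {0..1}"

lemma prob_space_unif: "prob_space unif"
  by (rule prob_space_uniform_measure) auto

interpretation unif: prob_space unif by (rule prob_space_unif)
interpretation uniform_seq: sequence_space unif
  by (simp add: sequence_space_def product_prob_space_def product_prob_space_axioms_def
      product_sigma_finite_def prob_space_unif unif.sigma_finite_measure_axioms)

lemma prob_space_Omega: "prob_space Omega"
  unfolding Omega_def by (rule prob_space_PiM) (rule prob_space_unif)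

interpretation OmegaP: prob_space Omega by (rule prob_space_Omega)

lemma measurable_Omega_component: "(\<lambda>\<omega>. \<omega> t) \<in> borel_measurable Omega"
proof -
  have "(\<lambda>\<omega>. \<omega> t) \<in> measurable Omega unif" unfolding Omega_def by measurable
  then show ?thesis by (simp cong: measurable_cong_sets)
qed

lemma measurable_path [measurable]:
  "(\<lambda>\<omega>. path Sm Sp k \<omega> t) \<in> measurable Omega (count_space UNIV)"
proof (induction t)
  case (Suc t)
  note [measurable] = Suc measurable_Omega_component
  show ?case unfolding path.simps by measurable
qed simp

text \<open>After the first step the gameplay is driven by the tail of the random sequence and by
  the strategies with their clock advanced by one.\<close>

lemma path_shift:
  "path Sm Sp k (case_nat u \<omega>) (Suc t) =
   path (\<lambda>i j. Sm i (Suc j)) (\<lambda>i j. Sp i (Suc j))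
     (if u < up_prob Sm Sp k 1 then k + 1 else k - 1) \<omega> t"
proof (induction t)
  case (Suc t)
  show ?case
    by (simp only: path.simps(2)[of _ _ _ _ "Suc t"] Suc) (simp add: up_prob_def)
qed simp

lemma up_prob_bounds:
  assumes "strategy Sm" "strategy Sp" "0 < j"
  shows "0 \<le> up_prob Sm Sp i j" "up_prob Sm Sp i j \<le> 1"
proof -
  have "0 \<le> Sm i j" "0 \<le> Sp i j" using assms by (auto simp: strategy_def)
  then show "0 \<le> up_prob Sm Sp i j" "up_prob Sm Sp i j \<le> 1"
    by (auto simp: up_prob_def divide_le_eq)
qed

lemma nn_integral_unif_if_less:
  assumes "0 \<le> p" "p \<le> 1"
  shows "(\<integral>\<^sup>+u. (if u < p then c else d) \<partial>unif) = ennreal p * c + ennreal (1 - p) * d"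
proof -
  have eqs: "{0..1} \<inter> {..<p} = {0..<p}" "{0..1} \<inter> {p..} = {p..1}" using assms by auto
  have "emeasure unif {..<p} = emeasure lborel ({0..1} \<inter> {..<p}) / emeasure lborel {0..1::real}"
    by (rule emeasure_uniform_measure) auto
  then have "emeasure unif {..<p} = ennreal p"
    unfolding eqs using assms divide_ennreal[of p 1] by (simp del: emeasure_uniform_measure)
  moreover have "emeasure unif {p..} = emeasure lborel ({0..1} \<inter> {p..}) / emeasure lborel {0..1::real}"
    by (rule emeasure_uniform_measure) auto
  then have "emeasure unif {p..} = ennreal (1 - p)"
    unfolding eqs using assms divide_ennreal[of "1 - p" 1] by (simp del: emeasure_uniform_measure)
  moreover have "(\<integral>\<^sup>+u. (if u < p then c else d) \<partial>unif) =
      (\<integral>\<^sup>+u. c * indicator {..<p} u + d * indicator {p..} u \<partial>unif)"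
    by (intro nn_integral_cong) (auto simp: indicator_def)
  ultimately show ?thesis
    by (simp add: nn_integral_add nn_integral_cmult mult.commute del: emeasure_uniform_measure)
qed

text \<open>Prepending an independent uniform variable to an i.i.d. uniform sequence gives such a
  sequence again; Tonelli separates the two.\<close>

lemma nn_integral_Omega_first_step:
  assumes [measurable]: "f \<in> borel_measurable Omega"
  shows "(\<integral>\<^sup>+\<omega>. f \<omega> \<partial>Omega) = (\<integral>\<^sup>+u. \<integral>\<^sup>+\<omega>. f (case_nat u \<omega>) \<partial>Omega \<partial>unif)"
proof -
  have [measurable]: "f \<in> borel_measurable (PiM UNIV (\<lambda>_. unif))"
    using assms by (simp add: Omega_def)
  have "(\<integral>\<^sup>+\<omega>. f \<omega> \<partial>Omega) =
      (\<integral>\<^sup>+\<omega>. f \<omega> \<partial>distr (unif \<Otimes>\<^sub>M Omega) Omega (\<lambda>(s, \<omega>). case_nat s \<omega>))"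
    using uniform_seq.PiM_iter by (simp add: Omega_def)
  also have "\<dots> = (\<integral>\<^sup>+x. f (case_nat (fst x) (snd x)) \<partial>(unif \<Otimes>\<^sub>M Omega))"
    unfolding Omega_def by (subst nn_integral_distr) (auto simp: case_prod_beta)
  also have "\<dots> = (\<integral>\<^sup>+u. \<integral>\<^sup>+\<omega>. f (case_nat u \<omega>) \<partial>Omega \<partial>unif)"
    unfolding Omega_def
    by (subst uniform_seq.P.nn_integral_fst[symmetric]) (auto simp: case_prod_beta)
  finally show ?thesis .
qed

text \<open>Stakes up to a finite horizon, valued in \<open>ennreal\<close> so that expectations
  exist without integrability conditions.\<close>

definition stake_sum where
  "stake_sum So X T = (\<Sum>t<T. ennreal (So (X t) (Suc t)))"
  for So :: "int \<Rightarrow> nat \<Rightarrow> real" and X :: "nat \<Rightarrow> int"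

lemma measurable_stake_sum [measurable]:
  "(\<lambda>\<omega>. stake_sum So (path Sm Sp k \<omega>) T) \<in> borel_measurable Omega"
  unfolding stake_sum_def by (intro borel_measurable_sum measurable_compose[OF measurable_path]) simp

lemma expectation_first_step:
  assumes "strategy Sm" "strategy Sp"
    and "\<And>u \<omega>. f (case_nat u \<omega>) = F (if u < up_prob Sm Sp k 1 then k + 1 else k - 1) \<omega>"
    and [measurable]: "f \<in> borel_measurable Omega"
  shows "(\<integral>\<^sup>+\<omega>. f \<omega> \<partial>Omega) =
    ennreal (up_prob Sm Sp k 1) * (\<integral>\<^sup>+\<omega>. F (k + 1) \<omega> \<partial>Omega) +
    ennreal (1 - up_prob Sm Sp k 1) * (\<integral>\<^sup>+\<omega>. F (k - 1) \<omega> \<partial>Omega)"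
proof -
  have "(\<integral>\<^sup>+\<omega>. f \<omega> \<partial>Omega) = (\<integral>\<^sup>+u. (if u < up_prob Sm Sp k 1
      then \<integral>\<^sup>+\<omega>. F (k + 1) \<omega> \<partial>Omega else \<integral>\<^sup>+\<omega>. F (k - 1) \<omega> \<partial>Omega) \<partial>unif)"
    by (subst nn_integral_Omega_first_step) (auto simp: assms(3) intro!: nn_integral_cong)
  then show ?thesis
    using up_prob_bounds[OF assms(1,2), of 1 k] by (simp add: nn_integral_unif_if_less)
qed

lemma expected_value_first_step:
  fixes k :: int
  assumes "strategy Sm" "strategy Sp"
  defines "p \<equiv> up_prob Sm Sp k 1"
  defines "Sm' \<equiv> \<lambda>i j. Sm i (Suc j)" and "Sp' \<equiv> \<lambda>i j. Sp i (Suc j)"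
  shows "(\<integral>\<^sup>+\<omega>. g (path Sm Sp k \<omega> (Suc T)) \<partial>Omega) =
    ennreal p * (\<integral>\<^sup>+\<omega>. g (path Sm' Sp' (k + 1) \<omega> T) \<partial>Omega) +
    ennreal (1 - p) * (\<integral>\<^sup>+\<omega>. g (path Sm' Sp' (k - 1) \<omega> T) \<partial>Omega)"
  unfolding p_def Sm'_def Sp'_def
  by (rule expectation_first_step[OF assms(1,2),
      where F = "\<lambda>k \<omega>. g (path (\<lambda>i j. Sm i (Suc j)) (\<lambda>i j. Sp i (Suc j)) k \<omega> T)"])
    (simp_all only: path_shift, (intro measurable_compose[OF measurable_path], simp)+)

lemma expected_stake_first_step:
  fixes k :: int and So :: "int \<Rightarrow> nat \<Rightarrow> real"
  assumes "strategy Sm" "strategy Sp"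
  defines "p \<equiv> up_prob Sm Sp k 1"
  defines "Sm' \<equiv> \<lambda>i j. Sm i (Suc j)" and "Sp' \<equiv> \<lambda>i j. Sp i (Suc j)" and "So' \<equiv> \<lambda>i j. So i (Suc j)"
  shows "(\<integral>\<^sup>+\<omega>. stake_sum So (path Sm Sp k \<omega>) (Suc T) \<partial>Omega) = ennreal (So k 1) +
    (ennreal p * (\<integral>\<^sup>+\<omega>. stake_sum So' (path Sm' Sp' (k + 1) \<omega>) T \<partial>Omega) +
     ennreal (1 - p) * (\<integral>\<^sup>+\<omega>. stake_sum So' (path Sm' Sp' (k - 1) \<omega>) T \<partial>Omega))"
proof -
  define f where "f \<omega> = (\<Sum>t<T. ennreal (So (path Sm Sp k \<omega> (Suc t)) (Suc (Suc t))))" for \<omega>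
  have [measurable]: "f \<in> borel_measurable Omega" unfolding f_def by (intro borel_measurable_sum measurable_compose[OF measurable_path]) simp
  have "(\<integral>\<^sup>+\<omega>. stake_sum So (path Sm Sp k \<omega>) (Suc T) \<partial>Omega) = (\<integral>\<^sup>+\<omega>. ennreal (So k 1) + f \<omega> \<partial>Omega)"
    unfolding stake_sum_def f_def by (subst sum.lessThan_Suc_shift) simp
  also have "\<dots> = ennreal (So k 1) + (\<integral>\<^sup>+\<omega>. f \<omega> \<partial>Omega)"
    by (subst nn_integral_add) (auto simp: OmegaP.emeasure_space_1)
  also have "(\<integral>\<^sup>+\<omega>. f \<omega> \<partial>Omega) =
    ennreal p * (\<integral>\<^sup>+\<omega>. stake_sum So' (path Sm' Sp' (k + 1) \<omega>) T \<partial>Omega) +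
    ennreal (1 - p) * (\<integral>\<^sup>+\<omega>. stake_sum So' (path Sm' Sp' (k - 1) \<omega>) T \<partial>Omega)"
    unfolding p_def
  proof (rule expectation_first_step[OF assms(1,2), where F = "\<lambda>k \<omega>. stake_sum So' (path Sm' Sp' k \<omega>) T"])
    show "f (case_nat u \<omega>) =
        stake_sum So' (path Sm' Sp' (if u < up_prob Sm Sp k 1 then k + 1 else k - 1) \<omega>) T" for u \<omega>
      by (simp only: f_def path_shift stake_sum_def Sm'_def Sp'_def So'_def)
  qed measurable
  finally show ?thesis .
qed

lemma strategy_Suc: "strategy S \<Longrightarrow> strategy (\<lambda>i j. S i (Suc j))"
  by (simp add: strategy_def)

lemma up_prob_Suc: "up_prob (\<lambda>i j. Sm i (Suc j)) (\<lambda>i j. Sp i (Suc j)) i j = up_prob Sm Sp i (Suc j)"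
  by (simp add: up_prob_def)

text \<open>The supermartingale bound with costs moved to the right, so that all integrands are
  nonnegative. The first step changes both the starting point and the strategies, hence the
  induction over arbitrary ones.\<close>

lemma expected_value_le:
  assumes "strategy Sm" "strategy Sp" "strategy So" "\<And>i. 0 \<le> v i"
    and "\<And>i j. 0 < j \<Longrightarrow> up_prob Sm Sp i j * v (i + 1) + (1 - up_prob Sm Sp i j) * v (i - 1) \<le> v i + So i j"
  shows "(\<integral>\<^sup>+\<omega>. ennreal (v (path Sm Sp k \<omega> T)) \<partial>Omega) \<le>
    ennreal (v k) + (\<integral>\<^sup>+\<omega>. stake_sum So (path Sm Sp k \<omega>) T \<partial>Omega)"
  using assms
proof (induction T arbitrary: Sm Sp So k)
  case 0
  then show ?case by (simp add: OmegaP.emeasure_space_1)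
next
  case (Suc T)
  define p where "p = up_prob Sm Sp k 1"
  have p: "0 \<le> p" "p \<le> 1" using up_prob_bounds[OF Suc.prems(1,2)] by (auto simp: p_def)
  let ?Sm = "\<lambda>i j. Sm i (Suc j)" and ?Sp = "\<lambda>i j. Sp i (Suc j)" and ?So = "\<lambda>i j. So i (Suc j)"
  let ?c = "\<lambda>l. \<integral>\<^sup>+\<omega>. stake_sum ?So (path ?Sm ?Sp l \<omega>) T \<partial>Omega"
  have IH: "(\<integral>\<^sup>+\<omega>. ennreal (v (path ?Sm ?Sp l \<omega> T)) \<partial>Omega) \<le> ennreal (v l) + ?c l" for l
    by (rule Suc.IH) (use Suc.prems in \<open>auto simp: strategy_Suc up_prob_Suc\<close>)
  have "(\<integral>\<^sup>+\<omega>. ennreal (v (path Sm Sp k \<omega> (Suc T))) \<partial>Omega) \<le>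
      ennreal p * (ennreal (v (k + 1)) + ?c (k + 1)) + ennreal (1 - p) * (ennreal (v (k - 1)) + ?c (k - 1))"
    unfolding expected_value_first_step[OF Suc.prems(1,2), of "\<lambda>i. ennreal (v i)"] p_def[symmetric]
    by (intro add_mono mult_left_mono IH) auto
  also have "\<dots> = ennreal (p * v (k + 1) + (1 - p) * v (k - 1)) +
      (ennreal p * ?c (k + 1) + ennreal (1 - p) * ?c (k - 1))"
    using p Suc.prems(4) by (simp add: ennreal_plus ennreal_mult distrib_left ac_simps)
  also have "ennreal (p * v (k + 1) + (1 - p) * v (k - 1)) \<le> ennreal (v k + So k 1)"
    using Suc.prems(5)[of 1 k] by (simp add: p_def ennreal_leI)
  also have "ennreal (v k + So k 1) = ennreal (v k) + ennreal (So k 1)"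
    using Suc.prems(3,4) by (simp add: strategy_def)
  finally show ?case
    unfolding expected_stake_first_step[OF Suc.prems(1,2), of So] p_def[symmetric]
    by (simp add: add.assoc add_mono)
qed

lemma expected_value_eq:
  assumes "strategy Sm" "strategy Sp" "strategy So" "\<And>i. 0 \<le> v i"
    and "\<And>i j. 0 < j \<Longrightarrow> up_prob Sm Sp i j * v (i + 1) + (1 - up_prob Sm Sp i j) * v (i - 1) = v i + So i j"
  shows "(\<integral>\<^sup>+\<omega>. ennreal (v (path Sm Sp k \<omega> T)) \<partial>Omega) =
    ennreal (v k) + (\<integral>\<^sup>+\<omega>. stake_sum So (path Sm Sp k \<omega>) T \<partial>Omega)"
  using assms
proof (induction T arbitrary: Sm Sp So k)
  case 0
  then show ?case by (simp add: OmegaP.emeasure_space_1 stake_sum_def)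
next
  case (Suc T)
  define p where "p = up_prob Sm Sp k 1"
  have p: "0 \<le> p" "p \<le> 1" using up_prob_bounds[OF Suc.prems(1,2)] by (auto simp: p_def)
  let ?Sm = "\<lambda>i j. Sm i (Suc j)" and ?Sp = "\<lambda>i j. Sp i (Suc j)" and ?So = "\<lambda>i j. So i (Suc j)"
  let ?c = "\<lambda>l. \<integral>\<^sup>+\<omega>. stake_sum ?So (path ?Sm ?Sp l \<omega>) T \<partial>Omega"
  have IH: "(\<integral>\<^sup>+\<omega>. ennreal (v (path ?Sm ?Sp l \<omega> T)) \<partial>Omega) = ennreal (v l) + ?c l" for l
    by (rule Suc.IH) (use Suc.prems in \<open>auto simp: strategy_Suc up_prob_Suc\<close>)
  have "(\<integral>\<^sup>+\<omega>. ennreal (v (path Sm Sp k \<omega> (Suc T))) \<partial>Omega) =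
      ennreal p * (ennreal (v (k + 1)) + ?c (k + 1)) + ennreal (1 - p) * (ennreal (v (k - 1)) + ?c (k - 1))"
    unfolding expected_value_first_step[OF Suc.prems(1,2), of "\<lambda>i. ennreal (v i)"] p_def[symmetric] IH ..
  also have "\<dots> = ennreal (p * v (k + 1) + (1 - p) * v (k - 1)) +
      (ennreal p * ?c (k + 1) + ennreal (1 - p) * ?c (k - 1))"
    using p Suc.prems(4) by (simp add: ennreal_plus ennreal_mult distrib_left ac_simps)
  also have "ennreal (p * v (k + 1) + (1 - p) * v (k - 1)) = ennreal (v k) + ennreal (So k 1)"
    using Suc.prems(3,4) Suc.prems(5)[of 1 k] by (simp add: p_def strategy_def)
  finally show ?case
    unfolding expected_stake_first_step[OF Suc.prems(1,2), of So] p_def[symmetric]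
    by (simp add: add.assoc)
qed

section \<open>From finite horizons to expected payoffs\<close>

lemma measurable_term_value [measurable]:
  "(\<lambda>\<omega>. term_value c d e (path Sm Sp k \<omega>)) \<in> borel_measurable Omega"
proof -
  have [measurable]: "Measurable.pred Omega (\<lambda>\<omega>. filterlim (path Sm Sp k \<omega>) at_bot sequentially)"
    "Measurable.pred Omega (\<lambda>\<omega>. filterlim (path Sm Sp k \<omega>) at_top sequentially)"
    unfolding filterlim_at_bot filterlim_at_top eventually_sequentially by measurable
  show ?thesis unfolding term_value_def by measurable
qed

lemma integrable_term_value: "integrable Omega (\<lambda>\<omega>. term_value c d e (path Sm Sp k \<omega>))"
proof (rule OmegaP.integrable_const_bound)
  show "AE \<omega> in Omega. norm (term_value c d e (path Sm Sp k \<omega>)) \<le> \<bar>c\<bar> + \<bar>d\<bar> + \<bar>e\<bar>"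
    by (auto simp: term_value_def)
qed measurable

lemma value_tendsto_term_value:
  fixes X :: "nat \<Rightarrow> int"
  assumes "(v \<longlongrightarrow> c) at_bot" "(v \<longlongrightarrow> d) at_top"
    and "filterlim X at_bot sequentially \<or> filterlim X at_top sequentially"
  shows "(\<lambda>t. v (X t)) \<longlonglongrightarrow> term_value c d e X"
  using assms filterlim_compose[of v _ _ X] by (auto simp: term_value_def)

text \<open>Let the horizon in \<open>expected_value_le\<close> grow. On escape \<open>v\<close>
  converges to the terminal value, otherwise \<open>e <= 0 <= v\<close>; Fatou's lemma bounds the
  expected terminal value by \<open>v k\<close> plus the expected total stake.\<close>

lemma exp_payoff_le:
  assumes S: "strategy Sm" "strategy Sp" "strategy So" and v: "\<And>i. 0 \<le> v i"
    and super: "\<And>i j. 0 < j \<Longrightarrow>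
      up_prob Sm Sp i j * v (i + 1) + (1 - up_prob Sm Sp i j) * v (i - 1) \<le> v i + So i j"
    and lim: "(v \<longlongrightarrow> c) at_bot" "(v \<longlongrightarrow> d) at_top" and cd: "0 \<le> c" "0 \<le> d" and e: "e \<le> 0"
  shows "exp_payoff Sm Sp So c d e k \<le> ereal (v k)"
proof -
  define C where "C = (\<integral>\<^sup>+\<omega>. (\<Sum>t. ennreal (So (path Sm Sp k \<omega> t) (Suc t))) \<partial>Omega)"
  have le: "(\<integral>\<^sup>+\<omega>. ennreal (v (path Sm Sp k \<omega> T)) \<partial>Omega) \<le> ennreal (v k) + C" for T
  proof -
    have "(\<integral>\<^sup>+\<omega>. stake_sum So (path Sm Sp k \<omega>) T \<partial>Omega) \<le> C"
      unfolding C_def stake_sum_def by (intro nn_integral_mono sum_le_suminf) auto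
    then show ?thesis
      using expected_value_le[OF S v super] by (meson add_left_mono order_trans)
  qed
  have meas: "(\<lambda>\<omega>. ennreal (v (path Sm Sp k \<omega> T))) \<in> borel_measurable Omega" for T
    by (rule measurable_compose[OF measurable_path]) simp
  \<comment> \<open>Raising \<open>e\<close> to 0 makes the terminal value nonnegative, as Fatou's
    lemma requires.\<close>
  have "(\<integral>\<omega>. term_value c d e (path Sm Sp k \<omega>) \<partial>Omega) \<le> (\<integral>\<omega>. term_value c d 0 (path Sm Sp k \<omega>) \<partial>Omega)"
    using e by (intro integral_mono integrable_term_value) (auto simp: term_value_def)
  moreover have "ennreal (\<integral>\<omega>. term_value c d 0 (path Sm Sp k \<omega>) \<partial>Omega) \<le> ennreal (v k) + C"
  proof -
    have "ennreal (\<integral>\<omega>. term_value c d 0 (path Sm Sp k \<omega>) \<partial>Omega) =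
        (\<integral>\<^sup>+\<omega>. ennreal (term_value c d 0 (path Sm Sp k \<omega>)) \<partial>Omega)"
      using cd by (intro nn_integral_eq_integral[symmetric] integrable_term_value) (auto simp: term_value_def)
    also have "\<dots> \<le> (\<integral>\<^sup>+\<omega>. liminf (\<lambda>T. ennreal (v (path Sm Sp k \<omega> T))) \<partial>Omega)"
    proof (rule nn_integral_mono)
      fix \<omega>
      let ?X = "path Sm Sp k \<omega>"
      show "ennreal (term_value c d 0 ?X) \<le> liminf (\<lambda>T. ennreal (v (?X T)))"
      proof (cases "filterlim ?X at_bot sequentially \<or> filterlim ?X at_top sequentially")
        case True
        then have "(\<lambda>T. ennreal (v (?X T))) \<longlonglongrightarrow> ennreal (term_value c d 0 ?X)"
          by (intro tendsto_ennrealI value_tendsto_term_value lim)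
        then show ?thesis by (simp add: lim_imp_Liminf)
      next
        case False
        then show ?thesis by (simp add: term_value_def)
      qed
    qed
    also have "\<dots> \<le> liminf (\<lambda>T. \<integral>\<^sup>+\<omega>. ennreal (v (path Sm Sp k \<omega> T)) \<partial>Omega)"
      by (rule nn_integral_liminf) (rule meas)
    also have "\<dots> \<le> limsup (\<lambda>T. \<integral>\<^sup>+\<omega>. ennreal (v (path Sm Sp k \<omega> T)) \<partial>Omega)"
      by (rule Liminf_le_Limsup) simp
    also have "\<dots> \<le> ennreal (v k) + C"
      by (rule Limsup_bounded) (simp add: le)
    finally show ?thesis .
  qed
  \<comment> \<open>An infinite \<open>C\<close> makes the payoff minus infinity; for finite
    \<open>C\<close> the bound is an inequality between reals.\<close>
  ultimately show ?thesis
    using v[of k] unfolding exp_payoff_def C_def[symmetric]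
    by (cases C) (auto simp: ennreal_plus[symmetric] enn2ereal_ennreal simp del: ennreal_plus)
qed

text \<open>Unit steps cannot jump over 0, so the sign is fixed after the last visit there; leaving
  every finite set then forces divergence on that side.\<close>

lemma nearest_neighbour_diverges:
  fixes X :: "nat \<Rightarrow> int"
  assumes step: "\<And>t. \<bar>X (Suc t) - X t\<bar> = 1" and fin: "\<And>i. finite {t. X t = i}"
  shows "filterlim X at_bot sequentially \<or> filterlim X at_top sequentially"
proof -
  have avoid: "\<forall>\<^sub>F t in sequentially. X t \<notin> A" if "finite A" for A
  proof -
    have "finite (\<Union>i\<in>A. {t. X t = i})" using that fin by blast
    also have "(\<Union>i\<in>A. {t. X t = i}) = {t. X t \<in> A}" by auto
    finally show ?thesis by (simp add: cofinite_eq_sequentially[symmetric] eventually_cofinite)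
  qed
  obtain N where N: "\<And>t. N \<le> t \<Longrightarrow> X t \<noteq> 0"
    using avoid[of "{0}"] by (auto simp: eventually_sequentially)
  show ?thesis
  proof (cases "0 < X N")
    case True
    have "0 < X t" if "N \<le> t" for t
      using that
    proof (induction t rule: dec_induct)
      case (step t)
      then show ?case using assms(1)[of t] N[of "Suc t"] by auto
    qed (rule True)
    then have pos: "\<forall>\<^sub>F t in sequentially. 0 < X t" by (auto simp: eventually_sequentially)
    have "\<forall>\<^sub>F t in sequentially. Z \<le> X t" for Z
      using avoid[of "{0..Z}", simplified] pos by eventually_elim auto
    then show ?thesis by (simp add: filterlim_at_top)
  next
    case False
    have "X t < 0" if "N \<le> t" for t
      using that
    proof (induction t rule: dec_induct)
      case (step t)
      then show ?case using assms(1)[of t] N[of "Suc t"] by auto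
    qed (use False N[of N] in auto)
    then have neg: "\<forall>\<^sub>F t in sequentially. X t < 0" by (auto simp: eventually_sequentially)
    have "\<forall>\<^sub>F t in sequentially. X t \<le> Z" for Z
      using avoid[of "{Z..0}", simplified] neg by eventually_elim auto
    then show ?thesis by (simp add: filterlim_at_bot)
  qed
qed

text \<open>Every visit to \<open>i\<close> costs the same \<open>s i > 0\<close>, whereas the terms
  of a convergent series tend to 0.\<close>

lemma finite_visits_of_finite_stakes:
  fixes X :: "nat \<Rightarrow> int"
  assumes s: "\<And>i. 0 < s i" and fin: "(\<Sum>t. ennreal (s (X t))) \<noteq> \<top>"
  shows "finite {t. X t = i}"
proof -
  have "summable (\<lambda>t. s (X t))"
    using s fin by (intro summable_suminf_not_top) (auto intro: less_imp_le)
  then have "(\<lambda>t. s (X t)) \<longlonglongrightarrow> 0" by (rule summable_LIMSEQ_zero)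
  then have "\<forall>\<^sub>F t in sequentially. s (X t) < s i" using s[of i] by (rule order_tendstoD)
  then have "\<forall>\<^sub>F t in sequentially. X t \<noteq> i" by eventually_elim auto
  then show ?thesis by (simp add: cofinite_eq_sequentially[symmetric] eventually_cofinite)
qed

text \<open>The value is bounded, so the expected total stake is finite; since every site carries a positive
  stake, the gameplay almost surely visits each site finitely often and hence escapes.\<close>

lemma exp_payoff_eq:
  assumes S: "strategy Sm" "strategy Sp" and s: "\<And>i. 0 < s i" and v: "\<And>i. 0 \<le> v i" "\<And>i. v i \<le> B"
    and harm: "\<And>i j. 0 < j \<Longrightarrow>
      up_prob Sm Sp i j * v (i + 1) + (1 - up_prob Sm Sp i j) * v (i - 1) = v i + s i"
    and lim: "(v \<longlongrightarrow> c) at_bot" "(v \<longlongrightarrow> d) at_top" and cd: "0 \<le> c" "0 \<le> d"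
  shows "exp_payoff Sm Sp (\<lambda>i j. s i) c d e k = ereal (v k)"
proof -
  define C where "C = (\<integral>\<^sup>+\<omega>. (\<Sum>t. ennreal (s (path Sm Sp k \<omega> t))) \<partial>Omega)"
  have meas: "(\<lambda>\<omega>. ennreal (g (path Sm Sp k \<omega> T))) \<in> borel_measurable Omega" for T and g :: "int \<Rightarrow> real"
    by (rule measurable_compose[OF measurable_path]) simp
  have "strategy (\<lambda>i j. s i)" using s by (simp add: strategy_def less_imp_le)
  then have eq: "(\<integral>\<^sup>+\<omega>. ennreal (v (path Sm Sp k \<omega> T)) \<partial>Omega) =
      ennreal (v k) + (\<integral>\<^sup>+\<omega>. stake_sum (\<lambda>i j. s i) (path Sm Sp k \<omega>) T \<partial>Omega)" for T
    by (intro expected_value_eq S v harm)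
  have "(\<lambda>T. \<Sum>t<T. \<integral>\<^sup>+\<omega>. ennreal (s (path Sm Sp k \<omega> t)) \<partial>Omega) \<longlonglongrightarrow> C"
    unfolding C_def by (subst nn_integral_suminf) (auto intro: meas summable_LIMSEQ)
  then have stakes: "(\<lambda>T. \<integral>\<^sup>+\<omega>. stake_sum (\<lambda>i j. s i) (path Sm Sp k \<omega>) T \<partial>Omega) \<longlonglongrightarrow> C"
    unfolding stake_sum_def by (subst nn_integral_sum) (auto intro: meas)
  have "(\<integral>\<^sup>+\<omega>. stake_sum (\<lambda>i j. s i) (path Sm Sp k \<omega>) T \<partial>Omega) \<le> ennreal B" for T
  proof -
    have "(\<integral>\<^sup>+\<omega>. stake_sum (\<lambda>i j. s i) (path Sm Sp k \<omega>) T \<partial>Omega) \<le>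
        (\<integral>\<^sup>+\<omega>. ennreal (v (path Sm Sp k \<omega> T)) \<partial>Omega)"
      unfolding eq by simp
    also have "\<dots> \<le> (\<integral>\<^sup>+\<omega>. ennreal B \<partial>Omega)"
      by (intro nn_integral_mono ennreal_leI v)
    finally show ?thesis by (simp add: OmegaP.emeasure_space_1)
  qed
  with stakes have "C \<le> ennreal B" by (intro LIMSEQ_le_const2[OF stakes]) auto
  then have C: "C \<noteq> \<top>" by (metis ennreal_neq_top neq_top_trans)
  have "AE \<omega> in Omega. (\<Sum>t. ennreal (s (path Sm Sp k \<omega> t))) \<noteq> \<infinity>"
    using C unfolding C_def by (intro nn_integral_PInf_AE borel_measurable_suminf meas) auto
  then have conv: "AE \<omega> in Omega. filterlim (path Sm Sp k \<omega>) at_bot sequentially \<or>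
      filterlim (path Sm Sp k \<omega>) at_top sequentially"
  proof eventually_elim
    case (elim \<omega>)
    then show ?case
      by (intro nearest_neighbour_diverges finite_visits_of_finite_stakes[OF s]) auto
  qed
  have "(\<lambda>T. \<integral>\<^sup>+\<omega>. ennreal (v (path Sm Sp k \<omega> T)) \<partial>Omega) \<longlonglongrightarrow>
      (\<integral>\<^sup>+\<omega>. ennreal (term_value c d 0 (path Sm Sp k \<omega>)) \<partial>Omega)"
  proof (rule nn_integral_dominated_convergence[where w = "\<lambda>_. ennreal B"])
    show "AE \<omega> in Omega. (\<lambda>T. ennreal (v (path Sm Sp k \<omega> T))) \<longlonglongrightarrow> ennreal (term_value c d 0 (path Sm Sp k \<omega>))"
      using conv by eventually_elim (intro tendsto_ennrealI value_tendsto_term_value lim)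
  qed (auto intro: meas ennreal_leI v simp: OmegaP.emeasure_space_1)
  moreover have "(\<lambda>T. \<integral>\<^sup>+\<omega>. ennreal (v (path Sm Sp k \<omega> T)) \<partial>Omega) \<longlonglongrightarrow> ennreal (v k) + C"
    unfolding eq by (intro tendsto_add tendsto_const stakes)
  ultimately have "(\<integral>\<^sup>+\<omega>. ennreal (term_value c d 0 (path Sm Sp k \<omega>)) \<partial>Omega) = ennreal (v k) + C"
    by (rule LIMSEQ_unique)
  moreover have "(\<integral>\<^sup>+\<omega>. ennreal (term_value c d 0 (path Sm Sp k \<omega>)) \<partial>Omega) =
      ennreal (\<integral>\<omega>. term_value c d 0 (path Sm Sp k \<omega>) \<partial>Omega)"
    using cd by (intro nn_integral_eq_integral integrable_term_value) (auto simp: term_value_def)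
  \<comment> \<open>The two integrands differ only on the null event of no escape.\<close>
  moreover have "(\<integral>\<omega>. term_value c d e (path Sm Sp k \<omega>) \<partial>Omega) = (\<integral>\<omega>. term_value c d 0 (path Sm Sp k \<omega>) \<partial>Omega)"
    using conv by (intro integral_cong_AE measurable_term_value) (auto simp: term_value_def)
  moreover have "0 \<le> (\<integral>\<omega>. term_value c d 0 (path Sm Sp k \<omega>) \<partial>Omega)"
    using cd by (intro integral_nonneg_AE) (auto simp: term_value_def)
  ultimately show ?thesis
    using v(1)[of k] C unfolding exp_payoff_def C_def[symmetric]
    by (cases C) (auto simp: ennreal_plus[symmetric] enn2ereal_ennreal simp del: ennreal_plus)
qed

section \<open>Best responses and equilibrium\<close>

text \<open>The two sides differ by the square \<open>(s - z)^2 / (r + z)\<close>, where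
  \<open>r\<close> is the opponent's stake and \<open>z\<close> the own one, so equality holds
  exactly at \<open>z = s\<close>.\<close>

lemma best_response:
  fixes s r z lo mid hi :: real
  assumes "0 < r" "0 \<le> z" "mid - lo = s\<^sup>2 / r" "hi - mid = 2 * s + r"
  shows "z / (r + z) * hi + r / (r + z) * lo \<le> mid + z"
proof -
  have lo: "lo = mid - s\<^sup>2 / r" and hi: "hi = mid + 2 * s + r" using assms by auto
  have "mid + z - (z / (r + z) * hi + r / (r + z) * lo) = (s - z)\<^sup>2 / (r + z)"
    unfolding lo hi using assms(1,2) by (simp add: divide_simps) (simp add: power2_eq_square algebra_simps)
  then show ?thesis using assms(1,2) by (smt (verit) divide_nonneg_nonneg zero_le_power2)
qed

lemma best_response_eq:
  fixes s r lo mid hi :: real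
  assumes "0 < r" "0 < s" "mid - lo = s\<^sup>2 / r" "hi - mid = 2 * s + r"
  shows "s / (r + s) * hi + r / (r + s) * lo = mid + s"
proof -
  have lo: "lo = mid - s\<^sup>2 / r" and hi: "hi = mid + 2 * s + r" using assms by auto
  show ?thesis
    unfolding lo hi using assms(1,2) by (simp add: divide_simps) (simp add: power2_eq_square algebra_simps)
qed

lemma int_increasing_bounds:
  fixes f :: "int \<Rightarrow> real"
  assumes step: "\<And>i. f i \<le> f (i + 1)" and lim: "(f \<longlongrightarrow> c) at_bot" "(f \<longlongrightarrow> d) at_top"
  shows "c \<le> f i" "f i \<le> d"
proof -
  have mono: "f i \<le> f j" if "i \<le> j" for i j
    using that
  proof (induction j rule: int_ge_induct)
    case (step j)
    then show ?case using assms(1)[of j] by linarith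
  qed simp
  show "c \<le> f i"
    using lim(1) eventually_mono[OF eventually_le_at_bot[of i] mono] by (rule tendsto_upperbound) simp_all
  show "f i \<le> d"
    using lim(2) eventually_mono[OF eventually_ge_at_top[of i] mono] by (rule tendsto_lowerbound) simp_all
qed

text \<open>Against the opponent's solution stakes, \<open>best_response\<close> with
  \<open>exp_payoff_le\<close> caps every deviation by \<open>m k\<close> or \<open>n k\<close>;
  \<open>best_response_eq\<close> with \<open>exp_payoff_eq\<close> shows that the solution stakes
  attain this cap.\<close>

lemma abmn_nash_eq:
  assumes abmn: "abmn_positive a b m n"
    and m: "(m \<longlongrightarrow> 0) at_bot" "(m \<longlongrightarrow> d) at_top" and n: "(n \<longlongrightarrow> c) at_bot" "(n \<longlongrightarrow> 0) at_top"
    and star: "mstar \<le> 0" "nstar \<le> 0"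
  shows "nash_eq 0 d c 0 mstar nstar (\<lambda>i j. b i) (\<lambda>i j. a i)"
proof -
  note diff = abmn_differences[OF abmn]
  have mstep: "m i \<le> m (i + 1)" for i using diff(1,2,4)[of i] by simp
  have m_bounds: "0 \<le> m i" "m i \<le> d" for i
    using int_increasing_bounds[OF mstep m] by auto
  have nstep: "n (- i) \<le> n (- (i + 1))" for i
    using diff(1,2,6)[of "- i"] by simp
  have n_bounds: "0 \<le> n i" "n i \<le> c" for i
    using int_increasing_bounds[of "\<lambda>i. n (- i)", OF nstep tendsto_reflect_int(1)[OF n(2)]
        tendsto_reflect_int(2)[OF n(1)], of "- i"] by auto
  have cd: "0 \<le> d" "0 \<le> c" using m_bounds[of 0] n_bounds[of 0] by auto
  have S: "strategy (\<lambda>i j. b i)" "strategy (\<lambda>i j. a i)"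
    using diff(1,2) by (auto simp: strategy_def less_imp_le)
  have up_a: "up_prob (\<lambda>i j. b i) Sp i j = Sp i j / (b i + Sp i j)"
      "1 - up_prob (\<lambda>i j. b i) Sp i j = b i / (b i + Sp i j)"
    if "strategy Sp" "0 < j" for Sp i j
  proof -
    have "0 < b i + Sp i j" using that diff(2)[of i] by (simp add: strategy_def add_pos_nonneg)
    then show "up_prob (\<lambda>i j. b i) Sp i j = Sp i j / (b i + Sp i j)"
      "1 - up_prob (\<lambda>i j. b i) Sp i j = b i / (b i + Sp i j)"
      by (auto simp: up_prob_def field_simps)
  qed
  have up_b: "up_prob Sm (\<lambda>i j. a i) i j = a i / (a i + Sm i j)"
      "1 - up_prob Sm (\<lambda>i j. a i) i j = Sm i j / (a i + Sm i j)"
    if "strategy Sm" "0 < j" for Sm i j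
  proof -
    have "0 < a i + Sm i j" using that diff(1)[of i] by (simp add: strategy_def add_pos_nonneg)
    then show "up_prob Sm (\<lambda>i j. a i) i j = a i / (a i + Sm i j)"
      "1 - up_prob Sm (\<lambda>i j. a i) i j = Sm i j / (a i + Sm i j)"
      by (auto simp: up_prob_def field_simps)
  qed
  have "exp_payoff (\<lambda>i j. b i) Sp Sp 0 d mstar k \<le> ereal (m k)" if "strategy Sp" for Sp k
  proof (rule exp_payoff_le[OF S(1) that that m_bounds(1) _ m _ cd(1) star(1)])
    fix i :: int and j :: nat assume "0 < j"
    then show "up_prob (\<lambda>i j. b i) Sp i j * m (i + 1) + (1 - up_prob (\<lambda>i j. b i) Sp i j) * m (i - 1)
        \<le> m i + Sp i j"
      unfolding up_a(2)[OF that \<open>0 < j\<close>] unfolding up_a(1)[OF that \<open>0 < j\<close>]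
      using that diff(2) by (intro best_response[OF _ _ diff(3,4)]) (auto simp: strategy_def)
  qed simp
  moreover have "exp_payoff (\<lambda>i j. b i) (\<lambda>i j. a i) (\<lambda>i j. a i) 0 d mstar k = ereal (m k)" for k
  proof (rule exp_payoff_eq[OF S diff(1) m_bounds _ m _ cd(1)])
    fix i :: int and j :: nat assume "0 < j"
    then show "up_prob (\<lambda>i j. b i) (\<lambda>i j. a i) i j * m (i + 1) +
        (1 - up_prob (\<lambda>i j. b i) (\<lambda>i j. a i) i j) * m (i - 1) = m i + a i"
      unfolding up_a(2)[OF S(2) \<open>0 < j\<close>] unfolding up_a(1)[OF S(2) \<open>0 < j\<close>] by (intro best_response_eq[OF diff(2,1,3,4)])
  qed simp
  moreover have "exp_payoff Sm (\<lambda>i j. a i) Sm c 0 nstar k \<le> ereal (n k)" if "strategy Sm" for Sm k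
  proof (rule exp_payoff_le[OF that S(2) that n_bounds(1) _ n cd(2) _ star(2)])
    \<comment> \<open>For Mina a step down is favourable, so \<open>n (i - 1)\<close> takes the
      place of \<open>hi\<close> in \<open>best_response\<close>.\<close>
    fix i :: int and j :: nat assume "0 < j"
    then show "up_prob Sm (\<lambda>i j. a i) i j * n (i + 1) + (1 - up_prob Sm (\<lambda>i j. a i) i j) * n (i - 1)
        \<le> n i + Sm i j"
      unfolding up_b(2)[OF that \<open>0 < j\<close>] unfolding up_b(1)[OF that \<open>0 < j\<close>] add.commute[of "a i / _ * _"]
      using that diff(1) by (intro best_response[OF _ _ diff(5,6)]) (auto simp: strategy_def)
  qed simp
  moreover have "exp_payoff (\<lambda>i j. b i) (\<lambda>i j. a i) (\<lambda>i j. b i) c 0 nstar k = ereal (n k)" for k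
  proof (rule exp_payoff_eq[OF S diff(2) n_bounds _ n cd(2)])
    fix i :: int and j :: nat assume "0 < j"
    then show "up_prob (\<lambda>i j. b i) (\<lambda>i j. a i) i j * n (i + 1) +
        (1 - up_prob (\<lambda>i j. b i) (\<lambda>i j. a i) i j) * n (i - 1) = n i + b i"
      unfolding up_b(2)[OF S(1) \<open>0 < j\<close>] unfolding up_b(1)[OF S(1) \<open>0 < j\<close>] add.commute[of "a i / _ * _"]
      by (intro best_response_eq[OF diff(1,2,5,6)])
  qed simp
  ultimately show ?thesis
    using S unfolding nash_eq_def maxine_payoff_def mina_payoff_def by simp
qed

section \<open>Equilibria of the standard game\<close>

text \<open>The ratios \<open>b i / a i\<close> are recorded because they are what tells two
  equilibria apart up to shift.\<close>

lemma nash_eq_from_orbit: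
  assumes "0 < y" "orbit_margin y = x" "mstar \<le> 0" "nstar \<le> 0"
  obtains a b where "nash_eq 0 1 x 0 mstar nstar (\<lambda>i j. b i) (\<lambda>i j. a i)"
    and "ratio_orbit (\<lambda>i. b i / a i)" "b 0 / a 0 = y"
proof -
  obtain \<beta> where \<beta>: "ratio_orbit \<beta>" "\<beta> 0 = y" using ratio_orbit_exists[OF assms(1)] by blast
  define a where "a i = inverse (full_sum (\<beta> i))" for i
  have a: "0 < a i" for i using \<beta>(1) by (simp add: a_def full_sum_pos ratio_orbit_def)
  then have "(\<lambda>i. \<beta> i * a i / a i) = \<beta>" by (simp add: fun_eq_iff less_imp_neq[THEN not_sym])
  moreover have "nash_eq 0 1 x 0 mstar nstar (\<lambda>i j. \<beta> i * a i) (\<lambda>i j. a i)"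
    unfolding a_def using \<beta> assms
    by (intro abmn_nash_eq[OF abmn_from_orbit]) auto
  ultimately show ?thesis
    using \<beta> a[of 0] by (intro that[of "\<lambda>i. \<beta> i * a i" a]) auto
qed

lemma lambda_ABMN_less_imp_orbit:
  assumes "lambda_ABMN < x"
  obtains y where "0 < y" "orbit_margin y < x"
proof -
  define M where "M = {mina_margin m n | a b m n. abmn_positive a b m n}"
  obtain \<beta> where "ratio_orbit \<beta>" using ratio_orbit_exists[of 1] by auto
  \<comment> \<open>Only for a nonempty set does a strict upper bound on \<open>Inf\<close> yield a
    member below it.\<close>
  then have "M \<noteq> {}" using abmn_from_orbit(1)[OF _ refl] unfolding M_def by blast
  moreover have "Inf M < x" using assms by (simp add: lambda_ABMN_def M_def)
  ultimately obtain r where "r \<in> M" "r < x" by (meson cInf_lessD)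
  then obtain a b m n where "abmn_positive a b m n" "mina_margin m n < x" by (auto simp: M_def)
  then show ?thesis
    using that[of "b 0 / a 0"] mina_margin_abmn abmn_differences(1,2) by simp
qed

lemma lambda_ABMN_nonneg: "0 \<le> lambda_ABMN"
proof (rule ccontr)
  assume "\<not> ?thesis"
  then obtain y where "0 < y" "orbit_margin y < 0"
    using lambda_ABMN_less_imp_orbit[of 0] by auto
  then show False using orbit_margin_pos[of y] by simp
qed

theorem mainTheorem5:
  fixes x mstar nstar :: real
  assumes "lambda_ABMN < x" and "x < inverse lambda_ABMN"
    and "mstar \<le> 0" and "nstar \<le> 0"
  shows "\<exists>a b a' b' :: int \<Rightarrow> real.
           nash_eq 0 1 x 0 mstar nstar (\<lambda>i j. b i) (\<lambda>i j. a i)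
         \<and> nash_eq 0 1 x 0 mstar nstar (\<lambda>i j. b' i) (\<lambda>i j. a' i)
         \<and> \<not> (\<exists>k::int. \<forall>i. b i = b' (i + k) \<and> a i = a' (i + k))"
proof -
  have x: "0 < x" using assms(1) lambda_ABMN_nonneg by simp
  \<comment> \<open>Since \<open>inverse 0 = 0\<close>, the value \<open>lambda_ABMN = 0\<close>
    would give \<open>x < 0\<close>.\<close>
  with assms(2) have "lambda_ABMN \<noteq> 0" by auto
  then have "lambda_ABMN < inverse x"
    using assms(2) x lambda_ABMN_nonneg by (simp add: field_simps)
  \<comment> \<open>A margin above \<open>x\<close> arises by inversion from one below
    \<open>inverse x\<close>.\<close>
  then obtain v where v: "0 < v" "orbit_margin v < inverse x"
    by (rule lambda_ABMN_less_imp_orbit)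
  obtain u where u: "0 < u" "orbit_margin u < x"
    using lambda_ABMN_less_imp_orbit[OF assms(1)] .
  have "x < orbit_margin (inverse v)"
    using less_imp_inverse_less[OF v(2) orbit_margin_pos[OF v(1)]] by (simp add: orbit_margin_inverse v(1))
  then obtain y z where yz: "u < y" "y < z" "ratio_step z < u" "orbit_margin y = x" "orbit_margin z = x"
    using orbit_margin_attained_twice[OF u, of "inverse v"] v(1) by auto
  \<comment> \<open>Thus \<open>y\<close> and \<open>z\<close> lie in the same open period above
    \<open>u\<close>, where \<open>ratio_orbit_fundamental_domain\<close> separates their
    orbits.\<close>
  have "ratio_step y < u" using ratio_step_mono[of y z] yz u by simp
  obtain a b where ab: "nash_eq 0 1 x 0 mstar nstar (\<lambda>i j. b i) (\<lambda>i j. a i)"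
      "ratio_orbit (\<lambda>i. b i / a i)" "b 0 / a 0 = y"
    using nash_eq_from_orbit[OF _ yz(4) assms(3,4)] u yz by (metis less_trans)
  obtain a' b' where ab': "nash_eq 0 1 x 0 mstar nstar (\<lambda>i j. b' i) (\<lambda>i j. a' i)"
      "ratio_orbit (\<lambda>i. b' i / a' i)" "b' 0 / a' 0 = z"
    using nash_eq_from_orbit[OF _ yz(5) assms(3,4)] u yz by (metis less_trans)
  have "\<not> (\<exists>k::int. \<forall>i. b i = b' (i + k) \<and> a i = a' (i + k))"
  proof
    assume "\<exists>k::int. \<forall>i. b i = b' (i + k) \<and> a i = a' (i + k)"
    then obtain k where k: "\<And>i. b i / a i = b' (i + k) / a' (i + k)" by auto
    have "b 0 / a 0 = b' 0 / a' 0"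
      by (rule ratio_orbit_fundamental_domain[OF ab(2) _ _ ab'(2) _ _ k, of u])
        (use yz \<open>ratio_step y < u\<close> ab(3) ab'(3) in auto)
    then show False using ab(3) ab'(3) yz by simp
  qed
  with ab(1) ab'(1) show ?thesis by blast
qed

end
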